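(* Let $d\ge1$, let $f:\mathbb{R}^d\to\mathbb{R}$ be an analytic function, $2\pi$-periodic in each argument, $f(\boldsymbol\psi)=\sum_{\boldsymbol\nu\in\mathbb{Z}^d}e^{i\boldsymbol\nu\cdot\boldsymbol\psi}f_{\boldsymbol\nu}$, with average $f_{\boldsymbol 0}=\alpha>0$, and let $\boldsymbol\omega\in\mathbb{R}^d$ satisfy the Diophantine condition $$|\boldsymbol\omega\cdot\boldsymbol\nu|\ge C_0|\boldsymbol\nu|^{-\tau}\qquad\forall\,\boldsymbol\nu\in\mathbb{Z}^d\setminus\{\boldsymbol0\},$$ for some positive constants $C_0$ and $\tau$, where $|\boldsymbol\nu|=|\nu_1|+\dots+|\nu_d|$. Consider the equation $$\varepsilon\ddot x+\dot x+\varepsilon x^2=\varepsilon f(\boldsymbol\omega t).$$ Then there exists $\varepsilon_0>0$ such that for all real $\varepsilon$ with $|\varepsilon|<\varepsilon_0$ there is a quasi-periodic solution $x(t)=x(t;\varepsilon)$ with the same frequency vector $\boldsymbol\omega$ as the forcing term. Such a solution extends to a function analytic in $\varepsilon$ in the domain $\mathcal{D}_R\setminus\{0\}$ with $R=\varepsilon_0$, where $\mathcal{D}_R$ is defined in the context.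
   Context: A quasi-periodic function with frequency vector $\boldsymbol\omega$ is a function of the form $x(t)=\sum_{\boldsymbol\nu\in\mathbb{Z}^d}e^{i\boldsymbol\nu\cdot\boldsymbol\omega t}x_{\boldsymbol\nu}$ (absolutely convergent Fourier series). For $R>0$ and $\lambda\in[0,1]$ let $\mathcal{B}_{\lambda R}(0)=\{\varepsilon\in\mathbb{C}:|\varepsilon|<\lambda R\}$, $\mathcal{D}_{R,\lambda}=\{\varepsilon=a+ib\in\mathcal{B}_{\lambda R}(0):a,b\in\mathbb{R},\ |a|\ge\lambda|b|\}$ and $\mathcal{D}_R=\bigcup_{\lambda\in[0,1]}\mathcal{D}_{R,\lambda}$. The set $\mathcal{D}_R\setminus\{0\}$ is open and has the origin on its boundary. *)

theory Defs
  imports "HOL-Analysis.Analysis"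
begin

definition int_inner :: "int ^ 'd \<Rightarrow> real ^ 'd \<Rightarrow> real" where
  "int_inner \<nu> \<psi> = (\<Sum>i\<in>UNIV. real_of_int (\<nu> $ i) * \<psi> $ i)"

definition int_l1_norm :: "int ^ 'd \<Rightarrow> int" where
  "int_l1_norm \<nu> = (\<Sum>i\<in>UNIV. \<bar>\<nu> $ i\<bar>)"

text \<open>A function of several real variables is analytic if near every point it is the sum of a
  power series; the index \<open>k\<close> is a multi-index.\<close>

definition real_analytic :: "(real ^ 'd \<Rightarrow> real) \<Rightarrow> bool" where
  "real_analytic f \<longleftrightarrow>
     (\<forall>p. \<exists>c :: nat ^ 'd \<Rightarrow> real. \<exists>r>0. \<forall>h. norm h < r \<longrightarrow>
        ((\<lambda>k. c k * (\<Prod>i\<in>UNIV. h $ i ^ (k $ i))) has_sum f (p + h)) UNIV)"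

definition multi_periodic :: "(real ^ 'd \<Rightarrow> real) \<Rightarrow> bool" where
  "multi_periodic f \<longleftrightarrow> (\<forall>\<psi> i. f (\<psi> + axis i (2 * pi)) = f \<psi>)"

definition has_fourier_coeffs :: "(real ^ 'd \<Rightarrow> real) \<Rightarrow> (int ^ 'd \<Rightarrow> complex) \<Rightarrow> bool" where
  "has_fourier_coeffs f fc \<longleftrightarrow>
     (\<forall>\<psi>. ((\<lambda>\<nu>. exp (\<i> * complex_of_real (int_inner \<nu> \<psi>)) * fc \<nu>)
            has_sum complex_of_real (f \<psi>)) UNIV)"

definition diophantine :: "real \<Rightarrow> real \<Rightarrow> real ^ 'd \<Rightarrow> bool" where
  "diophantine C\<^sub>0 \<tau> \<omega> \<longleftrightarrow>
     (\<forall>\<nu>. \<nu> \<noteq> 0 \<longrightarrow> \<bar>int_inner \<nu> \<omega>\<bar> \<ge> C\<^sub>0 * real_of_int (int_l1_norm \<nu>) powr (- \<tau>))"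

definition quasi_periodic :: "real ^ 'd \<Rightarrow> (real \<Rightarrow> complex) \<Rightarrow> bool" where
  "quasi_periodic \<omega> x \<longleftrightarrow>
     (\<exists>c :: int ^ 'd \<Rightarrow> complex. (\<lambda>\<nu>. norm (c \<nu>)) summable_on UNIV \<and>
        (\<forall>t. ((\<lambda>\<nu>. exp (\<i> * complex_of_real (int_inner \<nu> \<omega> * t)) * c \<nu>) has_sum x t) UNIV))"

definition is_solution ::
    "(real ^ 'd \<Rightarrow> real) \<Rightarrow> real ^ 'd \<Rightarrow> real \<Rightarrow> (real \<Rightarrow> real) \<Rightarrow> bool" where
  "is_solution f \<omega> \<epsilon> x \<longleftrightarrow>
     (\<exists>x' x''. \<forall>t. (x has_real_derivative x' t) (at t) \<and>
        (x' has_real_derivative x'' t) (at t) \<and>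
        \<epsilon> * x'' t + x' t + \<epsilon> * (x t)\<^sup>2 = \<epsilon> * f (t *\<^sub>R \<omega>))"

definition D_part :: "real \<Rightarrow> real \<Rightarrow> complex set" where
  "D_part R l = {\<epsilon>. norm \<epsilon> < l * R \<and> \<bar>Re \<epsilon>\<bar> \<ge> l * \<bar>Im \<epsilon>\<bar>}"

definition D_dom :: "real \<Rightarrow> complex set" where
  "D_dom R = (\<Union>l\<in>{0..1}. D_part R l)"

end

theory Submission
  imports Defs "HOL-Complex_Analysis.Cauchy_Integral_Formula"
begin

text \<open>Write \<open>x = \<surd>\<alpha> + u\<close>. Keeping the linear term \<open>2 \<surd>\<alpha> \<epsilon> u\<close> of the nonlinearity on the left turns the
  equation for the Fourier coefficients into \<open>u = T (f - \<alpha> - u * u)\<close>, where \<open>T\<close> divides the coefficient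
  of index \<open>\<nu>\<close> by \<open>\<kappa> - s\<^sup>2 + \<i> s / \<epsilon>\<close> with \<open>s = \<omega> \<cdot> \<nu>\<close> and \<open>\<kappa> = 2 \<surd>\<alpha>\<close>. On the sector
  \<open>\<bar>\<epsilon>\<bar> < \<lambda> R\<close>, \<open>\<bar>Re \<epsilon>\<bar> > \<lambda> \<bar>Im \<epsilon>\<bar>\<close> these divisors are at least of order \<open>\<lambda>\<close>, so \<open>T\<close> has norm of order
  \<open>1 / \<lambda>\<close> without any loss of derivatives, whereas \<open>T (f - \<alpha>)\<close> is of order \<open>\<lambda> R\<close> because \<open>f\<close> is smooth
  and \<open>\<omega>\<close> is Diophantine. Hence the quadratic map has a fixed point by majorants, for one \<open>R\<close> and all
  \<open>\<lambda>\<close>, and the solutions on the different sectors agree since they are limits of the same iterates.\<close>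

text \<open>Division by \<epsilon> gives u'' + u'/\<epsilon> + \<kappa> u = f - \<alpha> - u^2, and
  the divisor is the symbol of the left side. At index 0 it equals \<kappa>; splitting off
  \<open>sqrt \<alpha>\<close> achieves this, for otherwise the mean would meet the divisor 0. The
  obstacle is the imaginary axis: near it the real part of the divisor can vanish, and the imaginary
  part carries only a factor of order \<lambda>. The quadratic iteration converges when the norm of
  \<open>T\<close> times the l1 norm of the first iterate is small, so the loss 1/\<lambda> has to
  be offset by a factor \<lambda> in the first iterate; the remaining factor R then makes the
  product small for all \<lambda> at once. The gain rests on f - \<alpha> having mean zero, since
  for s = 0 the inverse divisor is 1/\<kappa> whatever \<epsilon> is. Small divisors are met only on
  the fixed coefficients of f: the nonlinear terms are estimated in the l1 convolution algebra by
  the norm of \<open>T\<close> alone, so losses do not accumulate along the iteration.\<close>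

no_notation Infinite_Set_Sum.abs_summable_on (infix \<open>abs'_summable'_on\<close> 50)

section \<open>Infinite sums\<close>

text \<open>Dominated convergence: by the Weierstrass test the finite partial sums converge
  uniformly on \<open>Y\<close>, so the limit and the sum may be interchanged. \<open>Y\<close>
  allows the domination to be checked only at nonzero steps of a difference quotient.\<close>

lemma infsum_tendsto_dominated:
  fixes f :: "'a \<Rightarrow> 'b \<Rightarrow> 'c::banach"
  assumes lim: "\<And>x. x \<in> A \<Longrightarrow> (f x \<longlongrightarrow> g x) G"
    and le: "\<And>x y. x \<in> A \<Longrightarrow> y \<in> Y \<Longrightarrow> norm (f x y) \<le> M x"
    and M: "M summable_on A"
    and ev: "\<forall>\<^sub>F y in G. y \<in> Y" and G: "G \<noteq> bot"
  shows "((\<lambda>y. \<Sum>\<^sub>\<infinity>x\<in>A. f x y) \<longlongrightarrow> (\<Sum>\<^sub>\<infinity>x\<in>A. g x)) G"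
proof -
  have gM: "norm (g x) \<le> M x" if "x \<in> A" for x
    by (rule tendsto_upperbound[OF tendsto_norm[OF lim[OF that]] _ G])
      (use ev le[OF that] in \<open>auto elim: eventually_mono\<close>)
  have "g summable_on A"
    by (rule abs_summable_summable, rule Infinite_Sum.abs_summable_on_comparison_test'[OF M gM])
  then have "(sum g \<longlongrightarrow> infsum g A) (finite_subsets_at_top A)"
    by (rule infsum_tendsto)
  moreover have "\<forall>\<^sub>F X in finite_subsets_at_top A. ((\<lambda>y. \<Sum>x\<in>X. f x y) \<longlongrightarrow> sum g X) G"
    using eventually_finite_subsets_at_top_weakI[of A "\<lambda>X. ((\<lambda>y. \<Sum>x\<in>X. f x y) \<longlongrightarrow> sum g X) G"]
    by (auto intro!: tendsto_sum lim)
  ultimately show ?thesis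
    using swap_uniform_limit'[OF _ _ Weierstrass_m_test_general[OF le M] ev] by simp
qed

lemma holomorphic_on_if_ball:
  assumes "\<And>z. z \<in> S \<Longrightarrow> \<exists>r>0. f holomorphic_on ball z r"
  shows "f holomorphic_on S"
  by (meson assms analytic_imp_holomorphic analytic_on_def)

lemma holomorphic_on_infsum:
  fixes f :: "'a \<Rightarrow> complex \<Rightarrow> complex"
  assumes S: "open S"
    and hol: "\<And>x. x \<in> A \<Longrightarrow> f x holomorphic_on S"
    and le: "\<And>x z. x \<in> A \<Longrightarrow> z \<in> S \<Longrightarrow> norm (f x z) \<le> M x"
    and M: "M summable_on A"
  shows "(\<lambda>z. \<Sum>\<^sub>\<infinity>x\<in>A. f x z) holomorphic_on S"
proof (rule holomorphic_on_if_ball)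
  fix z assume "z \<in> S"
  then obtain r where r: "r > 0" "cball z r \<subseteq> S"
    using S open_contains_cball by blast
  have sub: "ball z r \<subseteq> S"
    using r ball_subset_cball by blast
  have fin: "(\<lambda>w. \<Sum>x\<in>X. f x w) holomorphic_on S" if "X \<subseteq> A" for X
    using that by (intro holomorphic_intros hol) auto
  have "\<forall>\<^sub>F X in finite_subsets_at_top A. continuous_on (cball z r) (\<lambda>w. \<Sum>x\<in>X. f x w)
          \<and> (\<lambda>w. \<Sum>x\<in>X. f x w) holomorphic_on ball z r"
    by (rule eventually_finite_subsets_at_top_weakI)
      (use fin r sub in \<open>auto intro: holomorphic_on_subset intro!: holomorphic_on_imp_continuous_on\<close>)
  moreover have "uniform_limit (cball z r) (\<lambda>X w. \<Sum>x\<in>X. f x w) (\<lambda>w. \<Sum>\<^sub>\<infinity>x\<in>A. f x w) (finite_subsets_at_top A)"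
    by (rule Weierstrass_m_test_general[OF _ M]) (use le r in blast)
  ultimately have "(\<lambda>z. \<Sum>\<^sub>\<infinity>x\<in>A. f x z) holomorphic_on ball z r"
    by (rule holomorphic_uniform_limit) (rule finite_subsets_at_top_neq_bot)
  then show "\<exists>r>0. (\<lambda>z. \<Sum>\<^sub>\<infinity>x\<in>A. f x z) holomorphic_on ball z r"
    using r by blast
qed

section \<open>Convolution\<close>

text \<open>The values are generic because majorants are real while Fourier coefficients are
  complex; an abelian group of indices is all the algebra asks for.\<close>

definition conv :: "('g::ab_group_add \<Rightarrow> 'a::{banach, real_normed_field}) \<Rightarrow> ('g \<Rightarrow> 'a) \<Rightarrow> 'g \<Rightarrow> 'a"
  where "conv a b \<nu> = (\<Sum>\<^sub>\<infinity>\<mu>. a \<mu> * b (\<nu> - \<mu>))"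

text \<open>Fubini: the products \<open>a \<mu> * b \<rho>\<close> are absolutely summable over
  pairs, and \<open>(\<nu>, \<mu>)\<close> to \<open>(\<mu>, \<nu> - \<mu>)\<close> is a bijection
  of pairs. Rows of the transformed family are the convolution terms, and its total is the product
  of the two sums.\<close>

lemma
  fixes a b :: "'g::ab_group_add \<Rightarrow> 'a::{banach, real_normed_field}"
  assumes a: "a abs_summable_on UNIV" and b: "b abs_summable_on UNIV"
  shows conv_term_abs_summable: "(\<lambda>\<mu>. a \<mu> * b (\<nu> - \<mu>)) abs_summable_on UNIV"
    and conv_abs_summable: "conv a b abs_summable_on UNIV"
    and infsum_conv: "infsum (conv a b) UNIV = infsum a UNIV * infsum b UNIV"
proof -
  let ?p = "\<lambda>(\<mu>, \<rho>). a \<mu> * b \<rho>"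
  let ?q = "\<lambda>(\<nu>, \<mu>). a \<mu> * b (\<nu> - \<mu>)"
  have p: "?p abs_summable_on UNIV \<times> UNIV"
    unfolding Infinite_Sum.abs_summable_on_Sigma_iff
    by (auto simp: norm_mult infsum_cmult_right' abs_mult infsum_nonneg intro!: summable_on_cmult_right summable_on_cmult_left a b)
  have bij: "bij_betw (\<lambda>(\<nu>, \<mu>). (\<mu>, \<nu> - \<mu>)) (UNIV \<times> UNIV) (UNIV \<times> (UNIV :: 'g set))"
    by (rule bij_betwI[where g = "\<lambda>(\<mu>, \<rho>). (\<mu> + \<rho>, \<mu>)"]) auto
  have q: "?q abs_summable_on UNIV \<times> UNIV"
    using p summable_on_reindex_bij_betw[OF bij, of "\<lambda>x. norm (?p x)"]
    by (simp add: case_prod_unfold)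
  show t: "(\<lambda>\<mu>. a \<mu> * b (\<nu> - \<mu>)) abs_summable_on UNIV" for \<nu>
    using q unfolding Infinite_Sum.abs_summable_on_Sigma_iff by auto
  have "(\<lambda>\<nu>. \<Sum>\<^sub>\<infinity>\<mu>. norm (a \<mu> * b (\<nu> - \<mu>))) summable_on UNIV"
    using summable_on_Sigma_banach[of "\<lambda>\<nu> \<mu>. norm (a \<mu> * b (\<nu> - \<mu>))" UNIV "\<lambda>_. UNIV"] q
    by (simp add: case_prod_unfold)
  then show "conv a b abs_summable_on UNIV"
    by (rule Infinite_Sum.abs_summable_on_comparison_test')
      (simp add: conv_def norm_infsum_bound t)
  have "infsum (conv a b) UNIV = infsum ?q (UNIV \<times> UNIV)"
    unfolding conv_def using infsum_Sigma_banach[OF abs_summable_summable[OF q]] by simp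
  also have "\<dots> = infsum ?p (UNIV \<times> UNIV)"
    using infsum_reindex_bij_betw[OF bij, of ?p] by (simp add: case_prod_unfold)
  also have "\<dots> = (\<Sum>\<^sub>\<infinity>\<mu>. \<Sum>\<^sub>\<infinity>\<rho>. a \<mu> * b \<rho>)"
    using infsum_Sigma_banach[OF abs_summable_summable[OF p]] by simp
  also have "\<dots> = infsum a UNIV * infsum b UNIV"
    by (simp add: infsum_cmult_right' infsum_cmult_left')
  finally show "infsum (conv a b) UNIV = infsum a UNIV * infsum b UNIV" .
qed

lemma conv_nonneg: "(\<And>\<mu>. 0 \<le> a \<mu>) \<Longrightarrow> (\<And>\<mu>. 0 \<le> b \<mu>) \<Longrightarrow> 0 \<le> conv a b (\<nu> :: 'g::ab_group_add)"
  for a b :: "_ \<Rightarrow> real"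
  unfolding conv_def by (intro infsum_nonneg) auto

text \<open>Used with the characters exp (i s t), this reduces the value of a product at time t to
  the plain total in \<open>infsum_conv\<close>.\<close>

lemma conv_character:
  assumes e: "\<And>\<mu> \<nu>. e (\<mu> + \<nu>) = e \<mu> * e \<nu>"
  shows "conv (\<lambda>\<mu>. e \<mu> * a \<mu>) (\<lambda>\<mu>. e \<mu> * b \<mu>) \<nu> = e \<nu> * conv a b \<nu>"
proof -
  have "e \<mu> * a \<mu> * (e (\<nu> - \<mu>) * b (\<nu> - \<mu>)) = e \<nu> * (a \<mu> * b (\<nu> - \<mu>))" for \<mu>
    using e[of \<mu> "\<nu> - \<mu>"] by simp
  then show ?thesis
    unfolding conv_def by (simp only: infsum_cmult_right')
qed

text \<open>The hypothesis is the symmetry of the coefficients of a real function. Its stability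
  under convolution makes the solution real at real \<epsilon>.\<close>

lemma cnj_conv:
  assumes "\<And>\<mu>. cnj (a \<mu>) = a (- \<mu>)" "\<And>\<mu>. cnj (b \<mu>) = b (- \<mu>)"
  shows "cnj (conv a b \<nu>) = conv a b (- \<nu>)"
proof -
  have "cnj (conv a b \<nu>) = (\<Sum>\<^sub>\<infinity>\<mu>. a (- \<mu>) * b (- \<nu> - (- \<mu>)))"
    unfolding conv_def infsum_cnj[symmetric] by (simp add: assms)
  also have "\<dots> = conv a b (- \<nu>)"
    unfolding conv_def
    by (rule infsum_reindex_bij_betw[of uminus UNIV UNIV "\<lambda>\<mu>. a \<mu> * b (- \<nu> - \<mu>)"]) (rule bij_uminus)
  finally show ?thesis .
qed

text \<open>The engine of the majorant method: domination of increments survives squaring. Split x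
  x' - y y' as (x - y) x' + y (x' - y') and bound every factor by its majorant; the same identity
  for X and Y then collapses the bound to X X' - Y Y'.\<close>

lemma norm_conv_diff_le:
  fixes x y :: "'g::ab_group_add \<Rightarrow> 'a::{banach, real_normed_field}"
  assumes x: "\<And>\<mu>. norm (x \<mu>) \<le> X \<mu>" and y: "\<And>\<mu>. norm (y \<mu>) \<le> Y \<mu>"
    and xy: "\<And>\<mu>. norm (x \<mu> - y \<mu>) \<le> X \<mu> - Y \<mu>" and X: "X summable_on UNIV"
  shows "norm (conv x x \<nu> - conv y y \<nu>) \<le> conv X X \<nu> - conv Y Y \<nu>"
proof -
  have nn: "0 \<le> X \<mu>" "0 \<le> Y \<mu>" "Y \<mu> \<le> X \<mu>" for \<mu>
    using x[of \<mu>] y[of \<mu>] xy[of \<mu>] norm_ge_zero[of "x \<mu>"] norm_ge_zero[of "y \<mu>"] norm_ge_zero[of "x \<mu> - y \<mu>"]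
    by linarith+
  have Y: "Y summable_on UNIV"
    by (rule summable_on_comparison_test[OF X]) (use nn in auto)
  have s: "X abs_summable_on UNIV" "Y abs_summable_on UNIV"
    using X Y nn by simp_all
  have sx: "x abs_summable_on UNIV" "y abs_summable_on UNIV"
    using Infinite_Sum.abs_summable_on_comparison_test'[OF X x] Infinite_Sum.abs_summable_on_comparison_test'[OF Y y] by auto
  note hs = has_sum_infsum[OF abs_summable_summable[OF conv_term_abs_summable], folded conv_def]
  have d: "((\<lambda>\<mu>. p \<mu> * p (\<nu> - \<mu>) - q \<mu> * q (\<nu> - \<mu>)) has_sum (conv p p \<nu> - conv q q \<nu>)) UNIV"
    if "p abs_summable_on UNIV" "q abs_summable_on UNIV"
    for p q :: "'g::ab_group_add \<Rightarrow> 'b::{banach, real_normed_field}"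
    using has_sum_add[OF hs[OF that(1) that(1)] has_sum_uminusI[OF hs[OF that(2) that(2)]]]
    by simp
  show ?thesis
  proof (rule norm_infsum_le[OF d[OF sx] d[OF s]])
    fix \<mu>
    let ?r = "\<nu> - \<mu>"
    have "norm (x \<mu> * x ?r - y \<mu> * y ?r) = norm ((x \<mu> - y \<mu>) * x ?r + y \<mu> * (x ?r - y ?r))"
      by (simp add: algebra_simps)
    also have "\<dots> \<le> norm (x \<mu> - y \<mu>) * norm (x ?r) + norm (y \<mu>) * norm (x ?r - y ?r)"
      by (metis norm_mult norm_triangle_ineq)
    also have "\<dots> \<le> (X \<mu> - Y \<mu>) * X ?r + Y \<mu> * (X ?r - Y ?r)"
      by (intro add_mono mult_mono) (use x y xy nn in auto)
    finally show "norm (x \<mu> * x ?r - y \<mu> * y ?r) \<le> X \<mu> * X ?r - Y \<mu> * Y ?r"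
      by (simp add: algebra_simps)
  qed
qed

section \<open>Quadratic fixed points in the convolution algebra\<close>

text \<open>The value type is generic so that the same recursion, with real data, also produces the
  majorants.\<close>

fun qiter :: "('g::ab_group_add \<Rightarrow> 'a) \<Rightarrow> ('g \<Rightarrow> 'a) \<Rightarrow> nat \<Rightarrow> 'g \<Rightarrow> 'a::{banach, real_normed_field}"
  where
    "qiter T A 0 = (\<lambda>_. 0)"
  | "qiter T A (Suc n) = (\<lambda>\<nu>. A \<nu> - T \<nu> * conv (qiter T A n) (qiter T A n) \<nu>)"

text \<open>The pointwise \<open>lim\<close> refers to no majorant and no sector, so one function of
  \<epsilon> serves all sectors; convergence is established separately on each.\<close>

definition qlim :: "('g::ab_group_add \<Rightarrow> 'a) \<Rightarrow> ('g \<Rightarrow> 'a) \<Rightarrow> 'g \<Rightarrow> 'a::{banach, real_normed_field}"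
  where "qlim T A \<nu> = lim (\<lambda>n. qiter T A n \<nu>)"

lemma cnj_qiter:
  assumes "\<And>\<nu>. cnj (T \<nu>) = T (- \<nu>)" "\<And>\<nu>. cnj (A \<nu>) = A (- \<nu>)"
  shows "cnj (qiter T A n \<nu>) = qiter T A n (- \<nu>)"
proof (induction n arbitrary: \<nu>)
  case (Suc n)
  then show ?case
    using assms by (simp add: cnj_conv)
qed simp

text \<open>Summing the recursion v = w + K (v * v) over the group turns it into the scalar
  recursion v = W + K v^2 with W the total of \<open>w\<close>. The condition \<open>small\<close>
  says that the discriminant of its fixed-point equation is nonnegative, and it makes the interval
  from 0 to 2 W invariant.\<close>

locale majorant =
  fixes w :: "'g::ab_group_add \<Rightarrow> real" and K :: real
  assumes w_nonneg: "0 \<le> w \<nu>" and w_summable: "w summable_on UNIV"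
    and K_nonneg: "0 \<le> K" and small: "4 * K * infsum w UNIV \<le> 1"
begin

text \<open>The negative sign cancels the subtraction in \<open>qiter\<close>, so the majorants are
  nonnegative and increase.\<close>

definition V :: "nat \<Rightarrow> 'g \<Rightarrow> real" where "V = qiter (\<lambda>_. - K) w"

lemma V_simps [simp]: "V 0 \<nu> = 0" "V (Suc n) \<nu> = w \<nu> + K * conv (V n) (V n) \<nu>"
  by (simp_all add: V_def)

lemma V_nonneg: "0 \<le> V n \<nu>"
  by (induction n arbitrary: \<nu>) (simp_all add: conv_nonneg w_nonneg K_nonneg)

lemma V_sum: "V n summable_on UNIV \<and> infsum (V n) UNIV \<le> 2 * infsum w UNIV"
proof (induction n)
  case 0
  then show ?case by (simp add: infsum_nonneg w_nonneg)
next
  case (Suc n)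
  let ?W = "infsum w UNIV"
  have V: "V n abs_summable_on UNIV"
    using Suc by (simp add: V_nonneg)
  have c: "conv (V n) (V n) summable_on UNIV"
    by (rule abs_summable_summable) (rule conv_abs_summable[OF V V])
  have S: "V (Suc n) = (\<lambda>\<nu>. w \<nu> + K * conv (V n) (V n) \<nu>)"
    by auto
  have "infsum (V (Suc n)) UNIV = ?W + K * (infsum (V n) UNIV)\<^sup>2"
    unfolding S using infsum_conv[OF V V]
    by (simp add: infsum_add w_summable c summable_on_cmult_right infsum_cmult_right' power2_eq_square)
  also have "(infsum (V n) UNIV)\<^sup>2 \<le> (2 * ?W)\<^sup>2"
    using Suc by (intro power_mono) (auto simp: infsum_nonneg V_nonneg)
  also have "?W + K * (2 * ?W)\<^sup>2 = ?W + (4 * K * ?W) * ?W"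
    by (simp add: power2_eq_square)
  also have "\<dots> \<le> ?W + 1 * ?W"
    using small by (intro add_mono mult_right_mono) (auto simp: infsum_nonneg w_nonneg)
  finally show ?case
    unfolding S using K_nonneg by (simp add: summable_on_add w_summable c summable_on_cmult_right mult_left_mono)
qed

lemma V_Suc_ge: "V n \<nu> \<le> V (Suc n) \<nu>"
proof (induction n arbitrary: \<nu>)
  case (Suc n)
  \<comment> \<open>Here \<open>V\<close> is both the sequence and its own majorant; the nonnegative
    left side then yields monotonicity of the squares.\<close>
  have "norm (conv (V (Suc n)) (V (Suc n)) \<nu> - conv (V n) (V n) \<nu>)
      \<le> conv (V (Suc n)) (V (Suc n)) \<nu> - conv (V n) (V n) \<nu>"
    by (rule norm_conv_diff_le) (use Suc V_nonneg V_sum in \<open>auto simp del: V_simps\<close>)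
  then have "conv (V n) (V n) \<nu> \<le> conv (V (Suc n)) (V (Suc n)) \<nu>"
    by (smt (verit) norm_ge_zero)
  then show ?case
    using K_nonneg by (simp del: V_simps(2) add: V_simps(2)[of _ \<nu>] mult_left_mono)
qed (simp add: w_nonneg K_nonneg conv_nonneg)

lemma incseq_V: "incseq (\<lambda>n. V n \<nu>)"
  by (rule incseq_SucI) (rule V_Suc_ge)

definition Vlim :: "'g \<Rightarrow> real" where "Vlim \<nu> = lim (\<lambda>n. V n \<nu>)"

lemma V_finite_sum_le: "finite F \<Longrightarrow> sum (V n) F \<le> 2 * infsum w UNIV"
  using finite_sum_le_infsum[of "V n" UNIV F] V_sum[of n] V_nonneg[of n] by force

lemma V_tendsto: "(\<lambda>n. V n \<nu>) \<longlonglongrightarrow> Vlim \<nu>"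
proof -
  have "norm (V n \<nu>) \<le> 2 * infsum w UNIV" for n
    using V_finite_sum_le[of "{\<nu>}" n] V_nonneg[of n \<nu>] by simp
  then have "Bseq (\<lambda>n. V n \<nu>)"
    by (rule BseqI')
  then have "convergent (\<lambda>n. V n \<nu>)"
    using Bseq_monoseq_convergent incseq_V[of \<nu>] unfolding monoseq_iff by blast
  then show ?thesis
    by (simp add: convergent_LIMSEQ_iff Vlim_def)
qed

lemma V_le: "V n \<nu> \<le> Vlim \<nu>"
  by (rule incseq_le[OF incseq_V V_tendsto])

lemma Vlim_nonneg: "0 \<le> Vlim \<nu>"
  using V_le[of 0 \<nu>] by simp

lemma Vlim_summable: "Vlim summable_on UNIV"
proof (rule nonneg_bdd_above_summable_on)
  show "bdd_above (sum Vlim ` {F. F \<subseteq> UNIV \<and> finite F})"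
  proof (rule bdd_aboveI2)
    fix F :: "'g set" assume F: "F \<in> {F. F \<subseteq> UNIV \<and> finite F}"
    then show "sum Vlim F \<le> 2 * infsum w UNIV"
      by (intro LIMSEQ_le_const2[OF tendsto_sum[OF V_tendsto]]) (auto intro: V_finite_sum_le)
  qed
qed (rule Vlim_nonneg)

lemma conv_V_tendsto: "(\<lambda>n. conv (V n) (V n) \<nu>) \<longlonglongrightarrow> conv Vlim Vlim \<nu>"
  unfolding conv_def
proof (rule infsum_tendsto_dominated[where Y = UNIV])
  have V: "Vlim abs_summable_on UNIV"
    using Vlim_summable by (simp add: Vlim_nonneg)
  show "(\<lambda>\<mu>. Vlim \<mu> * Vlim (\<nu> - \<mu>)) summable_on UNIV"
    by (rule abs_summable_summable) (rule conv_term_abs_summable[OF V V])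
  show "norm (V n \<mu> * V n (\<nu> - \<mu>)) \<le> Vlim \<mu> * Vlim (\<nu> - \<mu>)" for n \<mu>
    by (auto simp: V_nonneg V_le Vlim_nonneg intro!: mult_mono)
qed (auto intro!: tendsto_mult V_tendsto)

end

text \<open>\<open>w\<close> and \<open>K\<close> belong to a whole sector, whereas \<open>T\<close>
  and \<open>A\<close> vary with \<epsilon>; keeping them apart yields estimates uniform in
  \<epsilon>.\<close>

locale majorized = majorant w K for w :: "'g::ab_group_add \<Rightarrow> real" and K +
  fixes T A :: "'g \<Rightarrow> complex"
  assumes T_le: "norm (T \<nu>) \<le> K" and A_le: "norm (A \<nu>) \<le> w \<nu>"
begin

text \<open>The two bounds are carried through one induction because
  \<open>norm_conv_diff_le\<close> needs the sizes of two successive iterates together with the size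
  of their difference.\<close>

lemma qiter_step_le: "norm (qiter T A n \<nu>) \<le> V n \<nu> \<and> norm (qiter T A (Suc n) \<nu> - qiter T A n \<nu>) \<le> V (Suc n) \<nu> - V n \<nu>"
proof (induction n arbitrary: \<nu>)
  case 0
  then show ?case
    using A_le by (simp add: conv_def)
next
  case (Suc n)
  let ?u = "qiter T A"
  have le: "norm (?u (Suc n) \<nu>) \<le> V (Suc n) \<nu>" for \<nu>
    using Suc[of \<nu>] norm_triangle_ineq[of "?u (Suc n) \<nu> - ?u n \<nu>" "?u n \<nu>"] by (simp del: qiter.simps V_simps)
  have "norm (conv (?u (Suc n)) (?u (Suc n)) \<nu> - conv (?u n) (?u n) \<nu>)
      \<le> conv (V (Suc n)) (V (Suc n)) \<nu> - conv (V n) (V n) \<nu>"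
    by (rule norm_conv_diff_le) (use Suc le V_sum in \<open>auto simp del: V_simps qiter.simps\<close>)
  then have "norm (T \<nu>) * norm (conv (?u (Suc n)) (?u (Suc n)) \<nu> - conv (?u n) (?u n) \<nu>)
      \<le> K * (conv (V (Suc n)) (V (Suc n)) \<nu> - conv (V n) (V n) \<nu>)"
    using T_le K_nonneg by (intro mult_mono) auto
  moreover have "?u (Suc (Suc n)) \<nu> - ?u (Suc n) \<nu> = - (T \<nu> * (conv (?u (Suc n)) (?u (Suc n)) \<nu> - conv (?u n) (?u n) \<nu>))"
    by (subst (1 2) qiter.simps) (simp del: qiter.simps add: algebra_simps)
  moreover have "V (Suc (Suc n)) \<nu> - V (Suc n) \<nu> = K * (conv (V (Suc n)) (V (Suc n)) \<nu> - conv (V n) (V n) \<nu>)"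
    by (subst (1 2) V_simps) (simp del: V_simps add: algebra_simps)
  ultimately show ?case
    using le by (simp del: qiter.simps V_simps add: norm_mult)
qed

lemma qiter_le: "norm (qiter T A n \<nu>) \<le> V n \<nu>"
  using qiter_step_le by blast

text \<open>The step bounds telescope. The right-hand side involves neither \<open>T\<close> nor
  \<open>A\<close>, so the rate of convergence is common to the sector.\<close>

lemma qiter_diff_le:
  assumes "n \<le> m"
  shows "norm (qiter T A m \<nu> - qiter T A n \<nu>) \<le> V m \<nu> - V n \<nu>"
  using assms
proof (induction m rule: dec_induct)
  case (step m)
  then show ?case
    using qiter_step_le[of m \<nu>] norm_triangle_ineq[of "qiter T A (Suc m) \<nu> - qiter T A m \<nu>" "qiter T A m \<nu> - qiter T A n \<nu>"]
    by (simp del: qiter.simps V_simps)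
qed simp

lemma qiter_tendsto: "(\<lambda>n. qiter T A n \<nu>) \<longlonglongrightarrow> qlim T A \<nu>"
proof -
  have "Cauchy (\<lambda>n. qiter T A n \<nu>)"
  proof (rule CauchyI)
    fix e :: real assume "e > 0"
    then obtain M where M: "\<And>m n. m \<ge> M \<Longrightarrow> n \<ge> M \<Longrightarrow> \<bar>V m \<nu> - V n \<nu>\<bar> < e"
      using LIMSEQ_imp_Cauchy[OF V_tendsto[of \<nu>]] unfolding Cauchy_iff real_norm_def by metis
    have "norm (qiter T A m \<nu> - qiter T A n \<nu>) \<le> \<bar>V m \<nu> - V n \<nu>\<bar>" for m n
      using qiter_diff_le[of n m \<nu>] qiter_diff_le[of m n \<nu>]
      by (cases "n \<le> m") (auto simp: norm_minus_commute)
    then show "\<exists>M. \<forall>m\<ge>M. \<forall>n\<ge>M. norm (qiter T A m \<nu> - qiter T A n \<nu>) < e"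
      using M by (meson order.strict_trans1)
  qed
  then show ?thesis
    by (simp add: Cauchy_convergent_iff convergent_LIMSEQ_iff qlim_def)
qed

lemma qlim_le: "norm (qlim T A \<nu>) \<le> Vlim \<nu>"
  by (rule LIMSEQ_le_const2[OF tendsto_norm[OF qiter_tendsto]]) (meson V_le order_trans qiter_le)

lemma qlim_diff_le: "norm (qlim T A \<nu> - qiter T A n \<nu>) \<le> Vlim \<nu> - V n \<nu>"
proof (rule tendsto_le[OF sequentially_bot])
  show "(\<lambda>m. norm (qiter T A m \<nu> - qiter T A n \<nu>)) \<longlonglongrightarrow> norm (qlim T A \<nu> - qiter T A n \<nu>)"
    by (intro tendsto_intros qiter_tendsto)
  show "(\<lambda>m. V m \<nu> - V n \<nu>) \<longlonglongrightarrow> Vlim \<nu> - V n \<nu>"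
    by (intro tendsto_intros V_tendsto)
  show "\<forall>\<^sub>F m in sequentially. norm (qiter T A m \<nu> - qiter T A n \<nu>) \<le> V m \<nu> - V n \<nu>"
    using eventually_ge_at_top[of n] by eventually_elim (rule qiter_diff_le)
qed

lemma qlim_abs_summable: "qlim T A abs_summable_on UNIV"
  by (rule Infinite_Sum.abs_summable_on_comparison_test'[OF Vlim_summable qlim_le])

text \<open>The convolution passes to the limit because its error is at most
  \<open>conv Vlim Vlim \<nu> - conv (V n) (V n) \<nu>\<close>, which tends to 0 by dominated
  convergence.\<close>

lemma qlim_fixed_point: "qlim T A \<nu> = A \<nu> - T \<nu> * conv (qlim T A) (qlim T A) \<nu>"
proof -
  let ?u = "qlim T A"
  have "norm (conv ?u ?u \<nu> - conv (qiter T A n) (qiter T A n) \<nu>) \<le> conv Vlim Vlim \<nu> - conv (V n) (V n) \<nu>" for n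
    by (rule norm_conv_diff_le[OF qlim_le qiter_le qlim_diff_le Vlim_summable])
  moreover have "(\<lambda>n. conv Vlim Vlim \<nu> - conv (V n) (V n) \<nu>) \<longlonglongrightarrow> 0"
    using tendsto_diff[OF tendsto_const conv_V_tendsto[of \<nu>], of "conv Vlim Vlim \<nu>"] by simp
  ultimately have "(\<lambda>n. conv ?u ?u \<nu> - conv (qiter T A n) (qiter T A n) \<nu>) \<longlonglongrightarrow> 0"
    by (rule Lim_null_comparison[OF always_eventually[OF allI]])
  then have "(\<lambda>n. conv (qiter T A n) (qiter T A n) \<nu>) \<longlonglongrightarrow> conv ?u ?u \<nu>"
    using tendsto_diff[OF tendsto_const[of "conv ?u ?u \<nu>"]] by fastforce
  then have "(\<lambda>n. qiter T A (Suc n) \<nu>) \<longlonglongrightarrow> A \<nu> - T \<nu> * conv ?u ?u \<nu>"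
    unfolding qiter.simps by (intro tendsto_intros)
  then show ?thesis
    using LIMSEQ_unique LIMSEQ_Suc[OF qiter_tendsto] by blast
qed

end

text \<open>Every iterate is holomorphic by induction, its convolution sum being dominated by that
  of \<open>V n\<close>; the limit is uniform on the sector because the error
  \<open>Vlim \<nu> - V n \<nu>\<close> is free of \<epsilon>.\<close>

lemma (in majorant) qlim_holomorphic:
  fixes T A :: "complex \<Rightarrow> 'g \<Rightarrow> complex"
  assumes S: "open S"
    and M: "\<And>\<epsilon>. \<epsilon> \<in> S \<Longrightarrow> majorized w K (T \<epsilon>) (A \<epsilon>)"
    and T: "\<And>\<nu>. (\<lambda>\<epsilon>. T \<epsilon> \<nu>) holomorphic_on S" and A: "\<And>\<nu>. (\<lambda>\<epsilon>. A \<epsilon> \<nu>) holomorphic_on S"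
  shows "(\<lambda>\<epsilon>. qlim (T \<epsilon>) (A \<epsilon>) \<nu>) holomorphic_on S"
proof -
  have hol: "(\<lambda>\<epsilon>. qiter (T \<epsilon>) (A \<epsilon>) n \<nu>) holomorphic_on S" for n \<nu>
  proof (induction n arbitrary: \<nu>)
    case (Suc n)
    have V: "V n abs_summable_on UNIV"
      using V_sum by (simp add: V_nonneg)
    have "(\<lambda>\<epsilon>. conv (qiter (T \<epsilon>) (A \<epsilon>) n) (qiter (T \<epsilon>) (A \<epsilon>) n) \<nu>) holomorphic_on S"
      unfolding conv_def
    proof (rule holomorphic_on_infsum[OF S])
      show "(\<lambda>\<mu>. V n \<mu> * V n (\<nu> - \<mu>)) summable_on UNIV"
        by (rule abs_summable_summable) (rule conv_term_abs_summable[OF V V])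
      show "norm (qiter (T \<epsilon>) (A \<epsilon>) n \<mu> * qiter (T \<epsilon>) (A \<epsilon>) n (\<nu> - \<mu>)) \<le> V n \<mu> * V n (\<nu> - \<mu>)"
        if "\<epsilon> \<in> S" for \<epsilon> \<mu>
        unfolding norm_mult
        by (intro mult_mono majorized.qiter_le[OF M[OF that]] V_nonneg) auto
    qed (intro holomorphic_intros Suc)
    then show ?case
      by (auto intro!: holomorphic_intros T A)
  qed simp
  show ?thesis
  proof (rule holomorphic_uniform_sequence[OF S hol])
    fix z assume "z \<in> S"
    then obtain d where d: "d > 0" "cball z d \<subseteq> S"
      using S open_contains_cball by blast
    have "uniform_limit (cball z d) (\<lambda>n \<epsilon>. qiter (T \<epsilon>) (A \<epsilon>) n \<nu>) (\<lambda>\<epsilon>. qlim (T \<epsilon>) (A \<epsilon>) \<nu>) sequentially"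
    proof (rule uniform_limitI)
      fix e :: real assume "e > 0"
      then have "\<forall>\<^sub>F n in sequentially. dist (V n \<nu>) (Vlim \<nu>) < e"
        using tendstoD[OF V_tendsto] by blast
      then show "\<forall>\<^sub>F n in sequentially. \<forall>\<epsilon>\<in>cball z d. dist (qiter (T \<epsilon>) (A \<epsilon>) n \<nu>) (qlim (T \<epsilon>) (A \<epsilon>) \<nu>) < e"
      proof eventually_elim
        case (elim n)
        then have "Vlim \<nu> - V n \<nu> < e"
          by (simp add: dist_real_def)
        then show ?case
          using majorized.qlim_diff_le[OF M] d(2)
          by (metis dist_norm norm_minus_commute order.strict_trans1 subsetD)
      qed
    qed
    then show "\<exists>d>0. cball z d \<subseteq> S \<and> uniform_limit (cball z d) (\<lambda>n \<epsilon>. qiter (T \<epsilon>) (A \<epsilon>) n \<nu>)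
        (\<lambda>\<epsilon>. qlim (T \<epsilon>) (A \<epsilon>) \<nu>) sequentially"
      using d by blast
  qed
qed

section \<open>Small divisors\<close>

text \<open>The symbol of u'' + u'/\<epsilon> + \<kappa> u at exp (i s t).\<close>

definition divisor :: "real \<Rightarrow> real \<Rightarrow> complex \<Rightarrow> complex"
  where "divisor \<kappa> s \<epsilon> = of_real (\<kappa> - s\<^sup>2) + \<i> * of_real s / \<epsilon>"

text \<open>\<open>D_part\<close> with both inequalities strict: this makes it open, as holomorphy
  requires, and excludes the origin.\<close>

definition sector :: "real \<Rightarrow> real \<Rightarrow> complex set"
  where "sector R l = {\<epsilon>. norm \<epsilon> < l * R \<and> \<bar>Re \<epsilon>\<bar> > l * \<bar>Im \<epsilon>\<bar>}"

lemma open_sector: "open (sector R l)"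
  unfolding sector_def by (intro open_Collect_conj open_Collect_less continuous_intros)

lemma sector_nonzero: "\<epsilon> \<in> sector R l \<Longrightarrow> \<epsilon> \<noteq> 0"
  by (auto simp: sector_def)

lemma cnj_divisor: "cnj (divisor \<kappa> s (of_real e)) = divisor \<kappa> (- s) (of_real e)"
  by (simp add: divisor_def)

text \<open>With \<open>1 / \<epsilon> = q - \<i> p\<close> the divisor is \<open>\<kappa> - s\<^sup>2 + s p + \<i> s q\<close>, and membership in the
  sector makes \<open>\<bar>q\<bar>\<close> at least of order \<open>l / \<bar>\<epsilon>\<bar>\<close>.\<close>

lemma sector_polar:
  assumes e: "\<epsilon> \<in> sector R l" and l: "0 < l" "l \<le> 1"
  obtains p q where "Re (divisor \<kappa> s \<epsilon>) = \<kappa> - s\<^sup>2 + s * p" "Im (divisor \<kappa> s \<epsilon>) = s * q"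
    "p\<^sup>2 + q\<^sup>2 = (1 / norm \<epsilon>)\<^sup>2" "l * \<bar>p\<bar> \<le> \<bar>q\<bar>" "l \<le> 2 * norm \<epsilon> * \<bar>q\<bar>"
proof
  let ?r = "norm \<epsilon>"
  let ?p = "Im \<epsilon> / ?r\<^sup>2" and ?q = "Re \<epsilon> / ?r\<^sup>2"
  have r: "?r > 0" "\<epsilon> \<noteq> 0"
    using sector_nonzero[OF e] by auto
  have ri: "?r\<^sup>2 = (Re \<epsilon>)\<^sup>2 + (Im \<epsilon>)\<^sup>2"
    by (simp add: cmod_power2)
  show "Re (divisor \<kappa> s \<epsilon>) = \<kappa> - s\<^sup>2 + s * ?p" "Im (divisor \<kappa> s \<epsilon>) = s * ?q"
    using r by (simp_all add: divisor_def Re_divide Im_divide cmod_power2)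
  have "?p\<^sup>2 + ?q\<^sup>2 = ((Re \<epsilon>)\<^sup>2 + (Im \<epsilon>)\<^sup>2) / (?r\<^sup>2)\<^sup>2"
    by (simp add: power_divide add_divide_distrib)
  also have "\<dots> = (1 / ?r)\<^sup>2"
    unfolding ri[symmetric] using r by (simp add: field_simps power2_eq_square)
  finally show pq: "?p\<^sup>2 + ?q\<^sup>2 = (1 / ?r)\<^sup>2" .
  have "l * \<bar>Im \<epsilon>\<bar> \<le> \<bar>Re \<epsilon>\<bar>"
    using e by (simp add: sector_def)
  then show lp: "l * \<bar>?p\<bar> \<le> \<bar>?q\<bar>"
    using r by (simp add: divide_right_mono)
  have "l * \<bar>?q\<bar> \<le> \<bar>?q\<bar>"
    using l by (intro mult_left_le_one_le) auto
  moreover have "1 / ?r \<le> \<bar>?p\<bar> + \<bar>?q\<bar>"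
  proof (rule power2_le_imp_le)
    have "(1 / ?r)\<^sup>2 = \<bar>?p\<bar>\<^sup>2 + \<bar>?q\<bar>\<^sup>2"
      unfolding pq[symmetric] power2_abs ..
    also have "\<dots> \<le> (\<bar>?p\<bar> + \<bar>?q\<bar>)\<^sup>2"
      unfolding power2_sum using mult_nonneg_nonneg[OF abs_ge_zero abs_ge_zero, of ?p ?q] by linarith
    finally show "(1 / ?r)\<^sup>2 \<le> (\<bar>?p\<bar> + \<bar>?q\<bar>)\<^sup>2" .
  qed simp
  then have "l * (1 / ?r) \<le> l * \<bar>?p\<bar> + l * \<bar>?q\<bar>"
    using l by (metis distrib_left less_imp_le mult_left_mono)
  ultimately have "l * (1 / ?r) \<le> 2 * \<bar>?q\<bar>"
    using lp by linarith
  then show "l \<le> 2 * ?r * \<bar>?q\<bar>"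
    using r by (simp add: field_simps)
qed

text \<open>Either the imaginary part s q is large enough, or |s q| is below \<kappa> l / 4. In the
  latter case l |p| \<le> |q| gives |s p| \<le> \<kappa> / 4, and l \<le> 2 |\<epsilon>| |q| makes s
  itself small, with s^2 \<le> \<kappa> / 4 by \<open>R\<^sup>2 * \<kappa> \<le> 1\<close>; so the
  real part keeps at least half of \<kappa>.\<close>

lemma divisor_lower_bound:
  assumes e: "\<epsilon> \<in> sector R l" and l: "0 < l" "l \<le> 1" and \<kappa>: "0 < \<kappa>" and R: "R\<^sup>2 * \<kappa> \<le> 1"
  shows "\<kappa> * l / 4 \<le> norm (divisor \<kappa> s \<epsilon>)"
proof -
  obtain p q where D: "Re (divisor \<kappa> s \<epsilon>) = \<kappa> - s\<^sup>2 + s * p" "Im (divisor \<kappa> s \<epsilon>) = s * q"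
    and lp: "l * \<bar>p\<bar> \<le> \<bar>q\<bar>" and q: "l \<le> 2 * norm \<epsilon> * \<bar>q\<bar>"
    using sector_polar[OF e l] by metis
  show ?thesis
  proof (cases "\<kappa> * l / 4 \<le> \<bar>s * q\<bar>")
    case True
    then show ?thesis
      using abs_Im_le_cmod[of "divisor \<kappa> s \<epsilon>"] D by simp
  next
    case False
    then have sq: "\<bar>s\<bar> * \<bar>q\<bar> \<le> \<kappa> * l / 4"
      by (simp add: abs_mult)
    have "l * \<bar>s * p\<bar> = \<bar>s\<bar> * (l * \<bar>p\<bar>)"
      by (simp add: abs_mult)
    also have "\<dots> \<le> \<bar>s\<bar> * \<bar>q\<bar>"
      using lp by (intro mult_left_mono) auto
    also have "\<dots> \<le> l * (\<kappa> / 4)"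
      using sq by (simp add: mult.commute)
    finally have sp: "\<bar>s * p\<bar> \<le> \<kappa> / 4"
      using l by simp
    have eR: "norm \<epsilon> \<le> l * R" and lR: "0 < l * R"
      using e norm_ge_zero[of \<epsilon>] by (auto simp: sector_def simp del: norm_ge_zero)
    have "l * \<bar>s\<bar> \<le> 2 * norm \<epsilon> * \<bar>q\<bar> * \<bar>s\<bar>"
      using q by (intro mult_right_mono) auto
    also have "\<dots> = 2 * norm \<epsilon> * (\<bar>s\<bar> * \<bar>q\<bar>)"
      by simp
    also have "\<dots> \<le> 2 * (l * R) * (\<kappa> * l / 4)"
      using eR sq lR by (intro mult_mono) auto
    also have "\<dots> = l * (l * (R * \<kappa> / 2))"
      by (simp add: field_simps)
    finally have "\<bar>s\<bar> \<le> l * (R * \<kappa> / 2)"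
      using l by simp
    also have "\<dots> \<le> R * \<kappa> / 2"
    proof -
      have "0 < R" using lR l by (simp add: zero_less_mult_iff)
      then show ?thesis using l \<kappa> by (simp add: mult_left_le_one_le)
    qed
    finally have "\<bar>s\<bar>\<^sup>2 \<le> (R * \<kappa> / 2)\<^sup>2"
      by (intro power_mono) auto
    then have "s\<^sup>2 \<le> (R\<^sup>2 * \<kappa>) * \<kappa> / 4"
      by (simp add: power2_eq_square mult_ac)
    also have "\<dots> \<le> \<kappa> / 4"
      using R \<kappa> by (simp add: mult_left_le_one_le)
    finally have "\<kappa> / 2 \<le> Re (divisor \<kappa> s \<epsilon>)"
      using sp D by linarith
    also have "\<dots> \<le> norm (divisor \<kappa> s \<epsilon>)"
      by (rule complex_Re_le_cmod)
    finally have "\<kappa> / 2 \<le> norm (divisor \<kappa> s \<epsilon>)" .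
    moreover have "\<kappa> * l \<le> \<kappa>"
      using l \<kappa> by simp
    ultimately show ?thesis
      using norm_ge_zero[of "divisor \<kappa> s \<epsilon>"] by linarith
  qed
qed

text \<open>This gain of a factor \<open>l * R\<close> makes the first iterate of order \<open>l\<close>, which compensates the
  norm \<open>1 / l\<close> of the inverse divisors.\<close>

lemma inverse_divisor_bound:
  assumes e: "\<epsilon> \<in> sector R l" and l: "0 < l" "l \<le> 1" and \<kappa>: "0 < \<kappa>" and R: "R\<^sup>2 * \<kappa> \<le> 1" "R \<le> 1"
    and s: "s \<noteq> 0"
  shows "norm (1 / divisor \<kappa> s \<epsilon>) \<le> l * R * ((16 + 256 * \<kappa>) * (1 + 1 / s\<^sup>2))"
proof -
  let ?D = "norm (divisor \<kappa> s \<epsilon>)" and ?r = "norm \<epsilon>"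
  obtain p q where D: "Re (divisor \<kappa> s \<epsilon>) = \<kappa> - s\<^sup>2 + s * p" "Im (divisor \<kappa> s \<epsilon>) = s * q"
    and pq: "p\<^sup>2 + q\<^sup>2 = (1 / ?r)\<^sup>2" and q: "l \<le> 2 * ?r * \<bar>q\<bar>"
    using sector_polar[OF e l] by metis
  have r: "0 < ?r" "?r < l * R"
    using e sector_nonzero[OF e] by (auto simp: sector_def)
  have R0: "0 < R"
    using less_trans[OF r] l by (simp add: zero_less_mult_iff)
  have D0: "0 < ?D"
    using divisor_lower_bound[OF e l \<kappa> R(1), of s] l \<kappa> by (smt (verit) divide_pos_pos mult_pos_pos)
  have DI: "\<bar>s * q\<bar> \<le> ?D" and DR: "\<bar>\<kappa> - s\<^sup>2 + s * p\<bar> \<le> ?D"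
    using abs_Im_le_cmod[of "divisor \<kappa> s \<epsilon>"] abs_Re_le_cmod[of "divisor \<kappa> s \<epsilon>"] D by auto
  \<comment> \<open>This lets bounds of order 1/|s| and of order 1/s^2 share one weight.\<close>
  have one_s: "1 / \<bar>s\<bar> \<le> 1 + 1 / s\<^sup>2"
  proof -
    have "0 \<le> (1 - 1 / \<bar>s\<bar>)\<^sup>2" by simp
    then have "2 * (1 / \<bar>s\<bar>) \<le> 1 + (1 / \<bar>s\<bar>)\<^sup>2"
      by (simp add: power2_diff)
    then have "2 * (1 / \<bar>s\<bar>) \<le> 1 + 1 / s\<^sup>2"
      by (simp add: power_divide)
    moreover have "0 \<le> 1 / \<bar>s\<bar>" by simp
    ultimately show ?thesis by linarith
  qed
  have big: "4 * ?r / \<bar>s\<bar> \<le> l * R * ((16 + 256 * \<kappa>) * (1 + 1 / s\<^sup>2))"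
  proof -
    have "?r * (4 * (1 / \<bar>s\<bar>)) \<le> l * R * ((16 + 256 * \<kappa>) * (1 + 1 / s\<^sup>2))"
      using r \<kappa> one_s l R0 by (intro mult_mono) auto
    then show ?thesis by (simp add: mult.commute)
  qed
  have s4: "\<bar>s\<bar> * (1 / (2 * ?r)) = 2 * (\<bar>s\<bar> / (4 * ?r))" "0 \<le> \<bar>s\<bar> / (4 * ?r)"
    by simp_all
  \<comment> \<open>Since p^2 + q^2 = 1/|\<epsilon>|^2, one of |p| and |q| is at least 1/(2
    |\<epsilon>|). If |q| is, the imaginary part is large and \<open>big\<close> concludes.\<close>
  show ?thesis
  proof (cases "1 / (2 * ?r) \<le> \<bar>q\<bar>")
    case True
    then have "\<bar>s\<bar> * (1 / (2 * ?r)) \<le> \<bar>s * q\<bar>"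
      by (simp add: abs_mult mult_left_mono del: times_divide_eq_right)
    then have "\<bar>s\<bar> / (4 * ?r) \<le> ?D"
      using DI s4 by linarith
    then have "1 / ?D \<le> 4 * ?r / \<bar>s\<bar>"
      using D0 s r by (simp add: field_simps)
    then show ?thesis
      using big by (simp add: norm_divide)
  next
    case False
    have "(1 / (2 * ?r))\<^sup>2 \<le> p\<^sup>2"
    proof -
      have "\<bar>q\<bar>\<^sup>2 \<le> (1 / (2 * ?r))\<^sup>2"
        using False by (intro power_mono) auto
      show ?thesis
      proof -
        have "(1 / (2 * ?r))\<^sup>2 = (1 / ?r)\<^sup>2 / 4" "0 \<le> (1 / ?r)\<^sup>2"
          by (simp_all add: power_divide power_mult_distrib)
        then show ?thesis
          using pq \<open>\<bar>q\<bar>\<^sup>2 \<le> (1 / (2 * ?r))\<^sup>2\<close> unfolding power2_abs by linarith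
      qed
    qed
    then have p: "1 / (2 * ?r) \<le> \<bar>p\<bar>"
      using r by (metis abs_ge_zero abs_le_square_iff abs_of_nonneg divide_nonneg_nonneg less_imp_le mult_nonneg_nonneg zero_le_numeral zero_le_one)
    \<comment> \<open>Unless \<open>s * p\<close> is balanced by s^2 or by \<kappa>, it dominates
      the real part. If s^2 is comparable, then |s| \<ge> 1/(8 |\<epsilon>|) and the imaginary part
      alone gives the bound 16 l R. If \<kappa> is comparable, then |s| \<le> 8 \<kappa> l R, and
      \<open>divisor_lower_bound\<close> becomes 256 \<kappa> l R / s^2. This is the origin of the
      constant 16 + 256 \<kappa>.\<close>
    consider "s\<^sup>2 \<le> \<bar>s * p\<bar> / 4" "\<kappa> \<le> \<bar>s * p\<bar> / 4" | "\<bar>s * p\<bar> / 4 < s\<^sup>2" | "\<bar>s * p\<bar> / 4 < \<kappa>"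
      by linarith
    then show ?thesis
    proof cases
      case 1
      have "\<bar>s\<bar> * (1 / (2 * ?r)) \<le> \<bar>s * p\<bar>"
        using p by (simp add: abs_mult mult_left_mono del: times_divide_eq_right)
      moreover have "\<bar>s * p\<bar> / 2 \<le> ?D"
        using 1 DR \<kappa> zero_le_power2[of s] by linarith
      ultimately have "\<bar>s\<bar> / (4 * ?r) \<le> ?D"
        using s4 by linarith
      then have "1 / ?D \<le> 4 * ?r / \<bar>s\<bar>"
        using D0 s r by (simp add: field_simps)
      then show ?thesis
        using big by (simp add: norm_divide)
    next
      case 2
      then have "\<bar>s\<bar> * (\<bar>p\<bar> / 4) < \<bar>s\<bar> * \<bar>s\<bar>"
        by (simp add: abs_mult power2_eq_square)
      then have "\<bar>p\<bar> / 4 < \<bar>s\<bar>"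
        using s by (subst (asm) mult_less_cancel_left_pos) auto
      then have "1 / (8 * ?r) \<le> \<bar>s\<bar>"
        using p by simp
      moreover have "l / (2 * ?r) \<le> \<bar>q\<bar>"
        using q r by (simp add: field_simps)
      ultimately have "1 / (8 * ?r) * (l / (2 * ?r)) \<le> \<bar>s\<bar> * \<bar>q\<bar>"
        using r l by (intro mult_mono) auto
      then have "l / (16 * ?r\<^sup>2) \<le> ?D"
        using DI by (simp add: abs_mult power2_eq_square)
      then have "1 / ?D \<le> 16 * (?r\<^sup>2 / l)"
        using D0 l r by (simp add: field_simps)
      also have "?r\<^sup>2 / l \<le> l * R"
      proof -
        have "?r\<^sup>2 \<le> (l * R)\<^sup>2"
          using r by (intro power_mono) auto
        also have "\<dots> = l * (l * R) * R"
          by (simp add: power2_eq_square)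
        also have "\<dots> \<le> l * (l * R) * 1"
          using R R0 l by (intro mult_left_mono) auto
        finally show ?thesis
          using l by (simp add: field_simps)
      qed
      also have "16 * (l * R) = l * R * (16 * 1)" by simp
      also have "\<dots> \<le> l * R * ((16 + 256 * \<kappa>) * (1 + 1 / s\<^sup>2))"
        using l R0 \<kappa> by (intro mult_left_mono mult_mono) auto
      finally show ?thesis
        by (simp add: norm_divide)
    next
      case 3
      have "\<bar>s\<bar> * (1 / (2 * ?r)) \<le> \<bar>s * p\<bar>"
        using p by (simp add: abs_mult mult_left_mono del: times_divide_eq_right)
      then have "\<bar>s\<bar> * (1 / (2 * ?r)) \<le> 4 * \<kappa>"
        using 3 by linarith
      then have "\<bar>s\<bar> \<le> 8 * \<kappa> * ?r"
        using r by (simp add: field_simps)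
      also have "\<dots> \<le> 8 * \<kappa> * (l * R)"
        using r \<kappa> by (intro mult_left_mono) auto
      finally have "\<bar>s\<bar>\<^sup>2 \<le> (8 * \<kappa> * (l * R))\<^sup>2"
        by (intro power_mono) auto
      then have s2: "s\<^sup>2 \<le> \<kappa> * l * (64 * \<kappa> * l * R\<^sup>2)"
        by (simp add: power2_eq_square mult_ac)
      have "1 / ?D \<le> 4 / (\<kappa> * l)"
        using divisor_lower_bound[OF e l \<kappa> R(1), of s] D0 \<kappa> l by (simp add: field_simps)
      also have "\<dots> \<le> 256 * \<kappa> * l * R\<^sup>2 / s\<^sup>2"
        using s2 s \<kappa> l by (simp add: field_simps)
      also have "\<dots> \<le> l * R * (256 * \<kappa> * (1 / s\<^sup>2))"
      proof -
        have "256 * \<kappa> * l * R * R * (1 / s\<^sup>2) \<le> 256 * \<kappa> * l * R * 1 * (1 / s\<^sup>2)"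
          using R R0 l \<kappa> by (intro mult_right_mono mult_left_mono) auto
        then show ?thesis
          by (simp add: power2_eq_square mult_ac)
      qed
      also have "\<dots> \<le> l * R * ((16 + 256 * \<kappa>) * (1 + 1 / s\<^sup>2))"
        using l R0 \<kappa> by (intro mult_left_mono mult_mono) auto
      finally show ?thesis
        by (simp add: norm_divide)
    qed
  qed
qed

text \<open>For \<open>s\<^sup>2 \<ge> 2 * \<kappa>\<close> the real part of the divisor at real \<open>\<epsilon>\<close> is at least \<open>s\<^sup>2 / 2\<close> in absolute
  value; this is the gain of two derivatives.\<close>

lemma square_over_divisor_bound:
  assumes "e \<noteq> 0" and \<kappa>: "0 < \<kappa>" and m: "0 < m" "m \<le> norm (divisor \<kappa> s (of_real e))"
  shows "norm (s\<^sup>2 / divisor \<kappa> s (of_real e)) \<le> 2 + 2 * \<kappa> / m"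
proof (cases "s\<^sup>2 \<le> 2 * \<kappa>")
  case True
  have "norm (s\<^sup>2 / divisor \<kappa> s (of_real e)) = s\<^sup>2 / norm (divisor \<kappa> s (of_real e))"
    by (simp add: norm_divide norm_power)
  also have "\<dots> \<le> 2 * \<kappa> / m"
    using True m \<kappa> by (intro frac_le) auto
  finally show ?thesis
    by simp
next
  case False
  have "Re (divisor \<kappa> s (of_real e)) = \<kappa> - s\<^sup>2"
    by (simp add: divisor_def Re_divide)
  then have "s\<^sup>2 / 2 \<le> norm (divisor \<kappa> s (of_real e))"
    using abs_Re_le_cmod[of "divisor \<kappa> s (of_real e)"] False by simp
  then have "s\<^sup>2 / norm (divisor \<kappa> s (of_real e)) \<le> 2"
    using m by (subst pos_divide_le_eq) auto
  moreover have "0 \<le> 2 * \<kappa> / m"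
    using \<kappa> m by simp
  ultimately show ?thesis
    by (simp add: norm_divide norm_power)
qed

section \<open>Absolutely convergent trigonometric sums\<close>

lemma norm_exp_i_minus_one_le: "norm (exp (\<i> * of_real x) - 1) \<le> \<bar>x\<bar>"
  using dist_exp_i_1[of x] abs_sin_x_le_abs_x[of "x / 2"] by simp

text \<open>Brings the derivative into the form of a limit to which
  \<open>infsum_tendsto_dominated\<close> applies.\<close>

lemma has_vector_derivative_iff_quotient:
  "(f has_vector_derivative D) (at t) \<longleftrightarrow> ((\<lambda>h. (f (t + h) - f t) /\<^sub>R h) \<longlongrightarrow> D) (at 0)"
proof -
  have "norm (f (t + h) - f t - h *\<^sub>R D) / norm h = norm ((f (t + h) - f t) /\<^sub>R h - D)" if "h \<noteq> 0" for h
  proof -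
    have "(f (t + h) - f t) /\<^sub>R h - D = (f (t + h) - f t - h *\<^sub>R D) /\<^sub>R h"
      using that by (simp add: scaleR_right_diff_distrib)
    then show ?thesis
      by (simp add: divide_inverse mult.commute)
  qed
  then have "((\<lambda>h. norm (f (t + h) - f t - h *\<^sub>R D) / norm h) \<longlongrightarrow> 0) (at 0) \<longleftrightarrow>
      ((\<lambda>h. norm ((f (t + h) - f t) /\<^sub>R h - D)) \<longlongrightarrow> 0) (at 0)"
    by (intro filterlim_cong refl) (auto simp: eventually_at_filter)
  then show ?thesis
    unfolding has_vector_derivative_def has_derivative_at
    by (simp add: tendsto_norm_zero_iff LIM_zero_iff bounded_linear_scaleR_left)
qed

text \<open>Termwise differentiation: a difference quotient of exp (i s t) is at most |s| in modulus
  for every step, since a chord is shorter than its arc, so the hypothesis on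
  \<open>s \<nu> * c \<nu>\<close> supplies the dominating family.\<close>

lemma trig_sum_has_vector_derivative:
  fixes c :: "'g \<Rightarrow> complex" and s :: "'g \<Rightarrow> real"
  assumes c: "c abs_summable_on UNIV" and sc: "(\<lambda>\<nu>. of_real (s \<nu>) * c \<nu>) abs_summable_on UNIV"
  shows "((\<lambda>t. \<Sum>\<^sub>\<infinity>\<nu>. exp (\<i> * of_real (s \<nu> * t)) * c \<nu>) has_vector_derivative
           (\<Sum>\<^sub>\<infinity>\<nu>. exp (\<i> * of_real (s \<nu> * t)) * (\<i> * of_real (s \<nu>) * c \<nu>))) (at t)"
proof -
  let ?e = "\<lambda>\<nu> t. exp (\<i> * of_real (s \<nu> * t)) :: complex"
  let ?q = "\<lambda>\<nu> h. ((?e \<nu> (t + h) - ?e \<nu> t) * c \<nu>) /\<^sub>R h"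
  have ec: "(\<lambda>\<nu>. ?e \<nu> t * c \<nu>) summable_on UNIV" for t
    by (rule abs_summable_summable) (use c in \<open>simp add: norm_mult\<close>)
  have "((\<lambda>h. \<Sum>\<^sub>\<infinity>\<nu>. ?q \<nu> h) \<longlongrightarrow> (\<Sum>\<^sub>\<infinity>\<nu>. ?e \<nu> t * (\<i> * of_real (s \<nu>) * c \<nu>))) (at 0)"
  proof (rule infsum_tendsto_dominated[where Y = "- {0}"])
    show "(\<lambda>\<nu>. norm (of_real (s \<nu>) * c \<nu>)) summable_on UNIV"
      by (rule sc)
    fix \<nu>
    have "((\<lambda>t. ?e \<nu> t * c \<nu>) has_vector_derivative ?e \<nu> t * (\<i> * of_real (s \<nu>) * c \<nu>)) (at t)"
    proof -
      have "((\<lambda>z. exp (\<i> * (of_real (s \<nu>) * z)) * c \<nu>) has_field_derivative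
          ?e \<nu> t * (\<i> * of_real (s \<nu>) * c \<nu>)) (at (of_real t))"
        by (rule derivative_eq_intros refl)+ simp
      from has_vector_derivative_real_field[OF this] show ?thesis
        by simp
    qed
    then show "(?q \<nu> \<longlongrightarrow> ?e \<nu> t * (\<i> * of_real (s \<nu>) * c \<nu>)) (at 0)"
      by (simp add: has_vector_derivative_iff_quotient left_diff_distrib)
  next
    fix \<nu> and h :: real assume "h \<in> - {0}"
    have "?e \<nu> (t + h) - ?e \<nu> t = ?e \<nu> t * (?e \<nu> h - 1)"
      by (simp add: distrib_left right_diff_distrib flip: exp_add)
    then have "norm (?q \<nu> h) = norm (?e \<nu> h - 1) * norm (c \<nu>) / \<bar>h\<bar>"
      by (simp add: norm_mult divide_inverse mult_ac)
    also have "\<dots> \<le> \<bar>s \<nu> * h\<bar> * norm (c \<nu>) / \<bar>h\<bar>"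
      by (intro divide_right_mono mult_right_mono norm_exp_i_minus_one_le) auto
    also have "\<dots> = norm (of_real (s \<nu>) * c \<nu>)"
      using \<open>h \<in> - {0}\<close> by (simp add: abs_mult norm_mult)
    finally show "norm (?q \<nu> h) \<le> norm (of_real (s \<nu>) * c \<nu>)" .
  qed (simp_all add: eventually_at_filter)
  moreover have "(\<Sum>\<^sub>\<infinity>\<nu>. ?q \<nu> h) = ((\<Sum>\<^sub>\<infinity>\<nu>. ?e \<nu> (t + h) * c \<nu>) - (\<Sum>\<^sub>\<infinity>\<nu>. ?e \<nu> t * c \<nu>)) /\<^sub>R h" for h
    using infsum_add[OF ec[of "t + h"] summable_on_uminus[THEN iffD2, OF ec[of t]]]
    by (simp only: left_diff_distrib infsum_scaleR_right infsum_uminus flip: diff_conv_add_uminus)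
  ultimately show ?thesis
    by (simp only: has_vector_derivative_iff_quotient)
qed

lemma trig_sum_mult:
  fixes c d :: "'g::ab_group_add \<Rightarrow> complex" and s :: "'g \<Rightarrow> real"
  assumes c: "c abs_summable_on UNIV" and d: "d abs_summable_on UNIV"
    and s: "\<And>\<mu> \<nu>. s (\<mu> + \<nu>) = s \<mu> + s \<nu>"
  shows "(\<Sum>\<^sub>\<infinity>\<nu>. exp (\<i> * of_real (s \<nu> * t)) * conv c d \<nu>) =
    (\<Sum>\<^sub>\<infinity>\<nu>. exp (\<i> * of_real (s \<nu> * t)) * c \<nu>) * (\<Sum>\<^sub>\<infinity>\<nu>. exp (\<i> * of_real (s \<nu> * t)) * d \<nu>)"
proof -
  let ?e = "\<lambda>\<nu>. exp (\<i> * of_real (s \<nu> * t)) :: complex"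
  have e: "?e (\<mu> + \<nu>) = ?e \<mu> * ?e \<nu>" for \<mu> \<nu>
    by (simp add: s distrib_right distrib_left exp_add)
  have "infsum (conv (\<lambda>\<mu>. ?e \<mu> * c \<mu>) (\<lambda>\<mu>. ?e \<mu> * d \<mu>)) UNIV
      = (\<Sum>\<^sub>\<infinity>\<nu>. ?e \<nu> * c \<nu>) * (\<Sum>\<^sub>\<infinity>\<nu>. ?e \<nu> * d \<nu>)"
    using c d by (intro infsum_conv) (simp_all add: norm_mult)
  moreover have "conv (\<lambda>\<mu>. ?e \<mu> * c \<mu>) (\<lambda>\<mu>. ?e \<mu> * d \<mu>) = (\<lambda>\<nu>. ?e \<nu> * conv c d \<nu>)"
    by (rule ext, rule conv_character, rule e)
  ultimately show ?thesis
    by simp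
qed

section \<open>Fourier series on the torus\<close>

lemma int_inner_add_left: "int_inner (\<mu> + \<nu>) \<psi> = int_inner \<mu> \<psi> + int_inner \<nu> \<psi>"
  by (simp add: int_inner_def distrib_right sum.distrib)

lemma int_inner_add_right: "int_inner \<nu> (\<psi> + \<eta>) = int_inner \<nu> \<psi> + int_inner \<nu> \<eta>"
  by (simp add: int_inner_def distrib_left sum.distrib)

lemma int_inner_minus_left: "int_inner (- \<nu>) \<psi> = - int_inner \<nu> \<psi>"
  by (simp add: int_inner_def sum_negf)

lemma int_inner_zero [simp]: "int_inner 0 \<psi> = 0" "int_inner \<nu> 0 = 0"
  by (simp_all add: int_inner_def)

lemma int_inner_scaleR: "int_inner \<nu> (t *\<^sub>R \<psi>) = int_inner \<nu> \<psi> * t"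
  by (simp add: int_inner_def sum_distrib_left mult_ac)

lemma int_inner_axis: "int_inner \<nu> (axis i h) = of_int (\<nu> $ i) * h"
  by (simp add: int_inner_def axis_def if_distrib cong: if_cong)

text \<open>Complex values are needed because modulation by a character leads out of the real
  functions.\<close>

definition fourier_series :: "(real ^ 'd \<Rightarrow> complex) \<Rightarrow> (int ^ 'd \<Rightarrow> complex) \<Rightarrow> bool"
  where "fourier_series F c \<longleftrightarrow>
    (\<forall>\<psi>. ((\<lambda>\<nu>. exp (\<i> * of_real (int_inner \<nu> \<psi>)) * c \<nu>) has_sum F \<psi>) UNIV)"

lemma has_fourier_coeffs_iff: "has_fourier_coeffs f c \<longleftrightarrow> fourier_series (\<lambda>\<psi>. of_real (f \<psi>)) c"
  by (simp add: has_fourier_coeffs_def fourier_series_def)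

text \<open>At the origin all characters equal 1, and unordered convergence of complex numbers is
  absolute.\<close>

lemma fourier_series_abs_summable:
  assumes "fourier_series F c"
  shows "c abs_summable_on UNIV"
proof -
  have "(c has_sum F 0) UNIV"
    using assms[unfolded fourier_series_def, rule_format, of 0] by simp
  then show ?thesis
    using has_sum_imp_summable summable_on_iff_abs_summable_on_complex by blast
qed

lemma fourier_series_shift:
  assumes "fourier_series F c"
  shows "fourier_series (\<lambda>\<psi>. F (\<psi> + \<eta>)) (\<lambda>\<nu>. exp (\<i> * of_real (int_inner \<nu> \<eta>)) * c \<nu>)"
proof -
  have e: "exp (\<i> * of_real (int_inner \<nu> (\<psi> + \<eta>))) * c \<nu> =
      exp (\<i> * of_real (int_inner \<nu> \<psi>)) * (exp (\<i> * of_real (int_inner \<nu> \<eta>)) * c \<nu>)" for \<nu> \<psi>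
    by (simp add: int_inner_add_right distrib_left exp_add)
  show ?thesis
    using assms unfolding fourier_series_def e[symmetric] by blast
qed

lemma fourier_series_add:
  assumes "fourier_series F c" "fourier_series G d"
  shows "fourier_series (\<lambda>\<psi>. F \<psi> + G \<psi>) (\<lambda>\<nu>. c \<nu> + d \<nu>)"
  using assms unfolding fourier_series_def distrib_left by (auto intro: has_sum_add)

lemma fourier_series_cmult:
  assumes "fourier_series F c"
  shows "fourier_series (\<lambda>\<psi>. k * F \<psi>) (\<lambda>\<nu>. k * c \<nu>)"
  unfolding fourier_series_def
proof
  fix \<psi>
  have "((\<lambda>\<nu>. k * (exp (\<i> * of_real (int_inner \<nu> \<psi>)) * c \<nu>)) has_sum k * F \<psi>) UNIV"
    using assms unfolding fourier_series_def by (intro has_sum_cmult_right) simp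
  then show "((\<lambda>\<nu>. exp (\<i> * of_real (int_inner \<nu> \<psi>)) * (k * c \<nu>)) has_sum k * F \<psi>) UNIV"
    by (simp add: mult_ac)
qed

lemma fourier_series_modulate:
  fixes F :: "real ^ 'd \<Rightarrow> complex"
  assumes "fourier_series F c"
  shows "fourier_series (\<lambda>\<psi>. exp (- (\<i> * of_real (int_inner \<mu> \<psi>))) * F \<psi>) (\<lambda>\<nu>. c (\<nu> + \<mu>))"
  unfolding fourier_series_def
proof
  fix \<psi>
  let ?e = "\<lambda>\<nu>::int ^ 'd. exp (\<i> * of_real (int_inner \<nu> \<psi>)) :: complex"
  have "((\<lambda>\<nu>. ?e (\<nu> + \<mu>) * c (\<nu> + \<mu>)) has_sum F \<psi>) UNIV"
    using has_sum_reindex_bij_betw[of "\<lambda>\<nu>. \<nu> + \<mu>" UNIV UNIV "\<lambda>\<nu>. ?e \<nu> * c \<nu>"] assms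
    by (simp add: fourier_series_def bij_plus_right)
  then have "((\<lambda>\<nu>. exp (- (\<i> * of_real (int_inner \<mu> \<psi>))) * (?e (\<nu> + \<mu>) * c (\<nu> + \<mu>))) has_sum
      exp (- (\<i> * of_real (int_inner \<mu> \<psi>))) * F \<psi>) UNIV"
    by (rule has_sum_cmult_right)
  then show "((\<lambda>\<nu>. ?e \<nu> * c (\<nu> + \<mu>)) has_sum exp (- (\<i> * of_real (int_inner \<mu> \<psi>))) * F \<psi>) UNIV"
    by (simp add: int_inner_add_left distrib_left exp_add exp_minus mult_ac)
qed

text \<open>Averaging over the two points \<open>\<psi>\<close> and \<open>\<psi> + \<eta>\<close> with \<open>\<nu> \<cdot> \<eta> = \<pi>\<close> removes the frequency \<open>\<nu>\<close>
  and keeps the mean; this replaces integration over the torus.\<close>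

lemma fourier_series_kill_frequencies:
  fixes F :: "real ^ 'd \<Rightarrow> complex"
  assumes "fourier_series F c" and "\<And>\<psi>. norm (F \<psi>) \<le> M" and "finite G" and "0 \<notin> G"
  shows "\<exists>F' c'. fourier_series F' c' \<and> (\<forall>\<psi>. norm (F' \<psi>) \<le> M) \<and> c' 0 = c 0 \<and>
    (\<forall>\<nu>\<in>G. c' \<nu> = 0) \<and> (\<forall>\<nu>. norm (c' \<nu>) \<le> norm (c \<nu>))"
  using assms(3,4)
proof (induction G)
  case empty
  then show ?case
    using assms(1,2) by auto
next
  case (insert g G)
  then obtain F' c' where F': "fourier_series F' c'" "\<And>\<psi>. norm (F' \<psi>) \<le> M"
    and c': "c' 0 = c 0" "\<And>\<nu>. \<nu> \<in> G \<Longrightarrow> c' \<nu> = 0" "\<And>\<nu>. norm (c' \<nu>) \<le> norm (c \<nu>)"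
    by auto
  obtain i where i: "g $ i \<noteq> 0"
    using insert.prems by (auto simp: vec_eq_iff)
  define \<eta> :: "real ^ 'd" where "\<eta> = axis i (pi / of_int (g $ i))"
  let ?e = "\<lambda>\<nu>. exp (\<i> * of_real (int_inner \<nu> \<eta>)) :: complex"
  \<comment> \<open>Averaging multiplies each coefficient by (1 + e)/2, of modulus at most 1, so
    frequencies removed earlier stay removed.\<close>
  let ?F = "\<lambda>\<psi>. 1/2 * (F' \<psi> + F' (\<psi> + \<eta>))" and ?c = "\<lambda>\<nu>. 1/2 * (c' \<nu> + ?e \<nu> * c' \<nu>)"
  have "?e g = -1"
    using i by (simp add: \<eta>_def int_inner_axis)
  then have "?c g = 0"
    by simp
  moreover have "norm (?c \<nu>) \<le> norm (c \<nu>)" for \<nu>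
  proof -
    have "norm (c' \<nu> + ?e \<nu> * c' \<nu>) \<le> norm (c' \<nu>) + norm (c' \<nu>)"
      by (rule order_trans[OF norm_triangle_ineq]) (simp add: norm_mult)
    then show ?thesis
      using c'(3)[of \<nu>] by (simp add: norm_mult)
  qed
  moreover have "norm (?F \<psi>) \<le> M" for \<psi>
    using norm_triangle_ineq[of "F' \<psi>" "F' (\<psi> + \<eta>)"] F'(2)[of \<psi>] F'(2)[of "\<psi> + \<eta>"]
    by (simp add: norm_mult)
  moreover have "fourier_series ?F ?c"
    by (intro fourier_series_cmult fourier_series_add fourier_series_shift F')
  ultimately show ?case
    using c' by (intro exI[of _ ?F] exI[of _ ?c]) auto
qed

text \<open>Remove the nonzero frequencies of a finite set that carries all but \<open>e\<close> of
  the absolute sum. The value at the origin is still bounded by \<open>M\<close> and differs from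
  the mean only by the tail.\<close>

lemma fourier_mean_bound:
  assumes F: "fourier_series F c" and M: "\<And>\<psi>. norm (F \<psi>) \<le> M"
  shows "norm (c 0) \<le> M"
proof (rule field_le_epsilon)
  fix e :: real assume e: "e > 0"
  have c: "c abs_summable_on UNIV"
    by (rule fourier_series_abs_summable[OF F])
  then obtain G where G: "finite G" "dist (\<Sum>\<nu>\<in>G. norm (c \<nu>)) (\<Sum>\<^sub>\<infinity>\<nu>. norm (c \<nu>)) \<le> e"
    using infsum_finite_approximation[OF c e] by blast
  define H where "H = insert 0 G"
  have H: "finite H" "0 \<in> H"
    using G by (auto simp: H_def)
  obtain F' c' where F': "fourier_series F' c'" "\<And>\<psi>. norm (F' \<psi>) \<le> M"
    and c': "c' 0 = c 0" "\<And>\<nu>. \<nu> \<in> H - {0} \<Longrightarrow> c' \<nu> = 0" "\<And>\<nu>. norm (c' \<nu>) \<le> norm (c \<nu>)"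
    using fourier_series_kill_frequencies[OF F M, of "H - {0}"] H by auto
  have "(c' has_sum F' 0) UNIV"
    using F'(1)[unfolded fourier_series_def, rule_format, of 0] by simp
  moreover have "sum c' H = c 0"
    using H c' by (simp add: sum.remove[of H 0])
  ultimately have "(c' has_sum (F' 0 - c 0)) (UNIV - H)"
    using has_sum_Diff[OF _ has_sum_finite[OF H(1), of c']] by simp
  moreover have "((\<lambda>\<nu>. norm (c \<nu>)) has_sum ((\<Sum>\<^sub>\<infinity>\<nu>. norm (c \<nu>)) - (\<Sum>\<nu>\<in>H. norm (c \<nu>)))) (UNIV - H)"
    by (rule has_sum_Diff[OF has_sum_infsum[OF c] has_sum_finite[OF H(1)]]) simp
  ultimately have "norm (F' 0 - c 0) \<le> (\<Sum>\<^sub>\<infinity>\<nu>. norm (c \<nu>)) - (\<Sum>\<nu>\<in>H. norm (c \<nu>))"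
    by (rule norm_infsum_le) (rule c')
  also have "\<dots> \<le> (\<Sum>\<^sub>\<infinity>\<nu>. norm (c \<nu>)) - (\<Sum>\<nu>\<in>G. norm (c \<nu>))"
    using H(1) by (intro diff_left_mono sum_mono2) (auto simp: H_def)
  also have "\<dots> \<le> e"
    using G(2) by (simp add: dist_real_def)
  finally show "norm (c 0) \<le> M + e"
    using F'(2)[of 0] norm_triangle_ineq4[of "F' 0" "F' 0 - c 0"] by simp
qed

lemma fourier_coeff_bound:
  assumes F: "fourier_series F c" and M: "\<And>\<psi>. norm (F \<psi>) \<le> M"
  shows "norm (c \<mu>) \<le> M"
proof -
  have "norm (c (0 + \<mu>)) \<le> M"
    by (rule fourier_mean_bound[OF fourier_series_modulate[OF F]])
      (metis M mult_minus_right norm_exp_i_times norm_mult mult_1 of_real_minus)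
  then show ?thesis
    by simp
qed

text \<open>Conjugating the series of a real function gives a second expansion of it. The difference
  of the two represents the zero function, and \<open>fourier_coeff_bound\<close> with M = 0 is the
  uniqueness theorem.\<close>

lemma fourier_coeffs_cnj:
  assumes f: "has_fourier_coeffs f c"
  shows "cnj (c \<nu>) = c (- \<nu>)"
proof -
  let ?d = "\<lambda>\<nu>. cnj (c (- \<nu>))"
  have "fourier_series (\<lambda>\<psi>. of_real (f \<psi>)) ?d"
    unfolding fourier_series_def
  proof
    fix \<psi>
    let ?t = "\<lambda>\<nu>. exp (\<i> * of_real (int_inner \<nu> \<psi>)) * c \<nu>"
    have "((\<lambda>\<nu>. ?t (- \<nu>)) has_sum of_real (f \<psi>)) UNIV"
      using has_sum_reindex_bij_betw[OF bij_uminus, of ?t] f by (simp add: has_fourier_coeffs_def)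
    then have "((\<lambda>\<nu>. cnj (?t (- \<nu>))) has_sum cnj (of_real (f \<psi>))) UNIV"
      by (subst has_sum_cnj_iff)
    then show "((\<lambda>\<nu>. exp (\<i> * of_real (int_inner \<nu> \<psi>)) * ?d \<nu>) has_sum of_real (f \<psi>)) UNIV"
      by (simp add: exp_cnj int_inner_minus_left)
  qed
  then have "fourier_series (\<lambda>\<psi>. of_real (f \<psi>) + - 1 * of_real (f \<psi>)) (\<lambda>\<nu>. c \<nu> + - 1 * ?d \<nu>)"
    using f unfolding has_fourier_coeffs_iff by (intro fourier_series_add fourier_series_cmult)
  from fourier_coeff_bound[OF this, of 0 "- \<nu>"] show ?thesis
    by simp
qed

section \<open>Decay of the Fourier coefficients\<close>

text \<open>Iterated differences stand in for derivatives: they act on a Fourier series without any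
  question of termwise differentiability. The domain is generic since they are applied both on the
  torus and to holomorphic functions of one variable.\<close>

definition fdiff :: "'a \<Rightarrow> ('a::ab_group_add \<Rightarrow> complex) \<Rightarrow> 'a \<Rightarrow> complex"
  where "fdiff h g x = g (x + h) - g x"

lemma fourier_series_fdiff:
  assumes F: "fourier_series F c"
  shows "fourier_series ((fdiff \<eta> ^^ k) F) (\<lambda>\<nu>. (exp (\<i> * of_real (int_inner \<nu> \<eta>)) - 1) ^ k * c \<nu>)"
proof (induction k)
  case (Suc k)
  show ?case
    using fourier_series_add[OF fourier_series_shift[OF Suc, of \<eta>] fourier_series_cmult[OF Suc, of "-1"]]
    by (simp add: fdiff_def[abs_def] algebra_simps)
qed (simp add: F)

text \<open>The radius shrinks by \<delta> twice: once so that Cauchy's inequality bounds the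
  derivative by B / \<delta>, and once more to contain the shifted point z + h. The segment between
  z and z + h then lies in the middle ball.\<close>

lemma fdiff_bound_step:
  assumes hol: "g holomorphic_on ball 0 r" and B: "\<And>z. z \<in> ball 0 r \<Longrightarrow> norm (g z) \<le> B"
    and \<delta>: "0 < \<delta>" and h: "norm h \<le> \<delta>"
  shows "fdiff h g holomorphic_on ball 0 (r - 2 * \<delta>)"
    and "z \<in> ball 0 (r - 2 * \<delta>) \<Longrightarrow> norm (fdiff h g z) \<le> norm h / \<delta> * B"
proof -
  have zh: "z + h \<in> ball 0 (r - \<delta>)" "z \<in> ball 0 (r - \<delta>)" if "z \<in> ball 0 (r - 2 * \<delta>)" for z
    using that h \<delta> norm_triangle_ineq[of z h] by auto
  have sub: "ball 0 (r - \<delta>) \<subseteq> ball (0::complex) r"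
    using \<delta> by auto
  have "(\<lambda>z. g (z + h)) holomorphic_on ball 0 (r - 2 * \<delta>)"
    by (rule holomorphic_on_compose_gen[OF _ hol, unfolded o_def])
      (use zh(1) sub in \<open>auto intro!: holomorphic_intros\<close>)
  moreover have "g holomorphic_on ball 0 (r - 2 * \<delta>)"
    by (rule holomorphic_on_subset[OF hol]) (use \<delta> in auto)
  ultimately show "fdiff h g holomorphic_on ball 0 (r - 2 * \<delta>)"
    unfolding fdiff_def[abs_def] by (rule holomorphic_on_diff)
  assume z: "z \<in> ball 0 (r - 2 * \<delta>)"
  have "norm (g (z + h) - g z) \<le> B / \<delta> * norm (z + h - z)"
  proof (rule field_differentiable_bound[OF convex_ball])
    fix w assume w: "w \<in> ball (0::complex) (r - \<delta>)"
    have cb: "cball w \<delta> \<subseteq> ball 0 r"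
    proof
      fix x assume "x \<in> cball w \<delta>"
      then show "x \<in> ball 0 r"
        using w norm_triangle_ineq2[of x w] by (simp add: dist_norm norm_minus_commute)
    qed
    show "(g has_field_derivative deriv g w) (at w within ball 0 (r - \<delta>))"
      using holomorphic_derivI[OF hol open_ball] sub w by blast
    have "norm ((deriv ^^ 1) g w) \<le> fact 1 * B / \<delta> ^ 1"
    proof (rule Cauchy_inequality[OF _ _ \<delta>])
      show "g holomorphic_on ball w \<delta>"
        by (rule holomorphic_on_subset[OF hol]) (use cb ball_subset_cball in blast)
      show "continuous_on (cball w \<delta>) g"
        by (rule continuous_on_subset[OF holomorphic_on_imp_continuous_on[OF hol] cb])
      show "norm (g x) \<le> B" if "norm (w - x) = \<delta>" for x
        by (rule B) (use that cb in \<open>auto simp: dist_norm\<close>)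
    qed
    then show "norm (deriv g w) \<le> B / \<delta>"
      by simp
  qed (use zh[OF z] in auto)
  then show "norm (fdiff h g z) \<le> norm h / \<delta> * B"
    by (simp add: fdiff_def mult_ac)
qed

lemma fdiff_bound:
  assumes hol: "g holomorphic_on ball 0 r" and B: "\<And>z. z \<in> ball 0 r \<Longrightarrow> norm (g z) \<le> B"
    and \<delta>: "0 < \<delta>" and h: "norm h \<le> \<delta>"
  shows "(fdiff h ^^ k) g holomorphic_on ball 0 (r - 2 * real k * \<delta>) \<and>
    (\<forall>z\<in>ball 0 (r - 2 * real k * \<delta>). norm ((fdiff h ^^ k) g z) \<le> (norm h / \<delta>) ^ k * B)"
proof (induction k)
  case (Suc k)
  have r: "r - 2 * real (Suc k) * \<delta> = r - 2 * real k * \<delta> - 2 * \<delta>"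
    by (simp add: algebra_simps)
  from fdiff_bound_step[where g = "(fdiff h ^^ k) g" and r = "r - 2 * real k * \<delta>"
      and B = "(norm h / \<delta>) ^ k * B", OF _ _ \<delta> h] Suc
  show ?case
    unfolding r funpow.simps o_def power_Suc mult.assoc[of "norm h / \<delta>"] by simp
qed (use assms in simp)

text \<open>Only one coordinate is made complex, so one-variable function theory suffices. Width and
  bound are explicit parameters so that they can later be chosen independently of \<psi>.\<close>

definition line_extension :: "(real ^ 'd \<Rightarrow> real) \<Rightarrow> 'd \<Rightarrow> real \<Rightarrow> real \<Rightarrow> real ^ 'd \<Rightarrow> bool"
  where "line_extension f i \<rho> B \<psi> \<longleftrightarrow> (\<exists>G. G holomorphic_on ball 0 \<rho> \<and> (\<forall>z\<in>ball 0 \<rho>. norm (G z) \<le> B) \<and>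
    (\<forall>\<theta>. \<bar>\<theta>\<bar> < \<rho> \<longrightarrow> G (of_real \<theta>) = of_real (f (\<psi> + axis i \<theta>))))"

lemma line_extension_mono:
  assumes "line_extension f i \<rho> B \<psi>" "\<rho>' \<le> \<rho>" "B \<le> B'"
  shows "line_extension f i \<rho>' B' \<psi>"
proof -
  have "ball 0 \<rho>' \<subseteq> ball (0::complex) \<rho>"
    using assms(2) by auto
  then show ?thesis
    using assms unfolding line_extension_def
    by (meson holomorphic_on_subset order_less_le_trans order_trans subsetD)
qed

lemma fdiff_line_extension:
  assumes "\<And>\<theta>. \<bar>\<theta>\<bar> < \<rho> \<Longrightarrow> G (of_real \<theta>) = of_real (f (\<psi> + axis i \<theta>))"
    and "0 \<le> \<theta>" "0 \<le> h" "\<theta> + real k * h < \<rho>"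
  shows "(fdiff (of_real h) ^^ k) G (of_real \<theta>) = (fdiff (axis i h) ^^ k) (\<lambda>\<psi>. of_real (f \<psi>)) (\<psi> + axis i \<theta>)"
  using assms(2-)
proof (induction k arbitrary: \<theta>)
  case 0
  then show ?case
    using assms(1)[of \<theta>] by simp
next
  case (Suc k)
  have ax: "axis i \<theta> + axis i h = axis i (\<theta> + h)"
    by (simp add: vec_eq_iff axis_def)
  have "0 \<le> real k * h"
    using Suc.prems by simp
  then show ?case
    using Suc.IH[of \<theta>] Suc.IH[of "\<theta> + h"] Suc.prems
    by (simp add: fdiff_def ax add.assoc algebra_simps)
qed

lemma fdiff_line_extension_bound:
  assumes ext: "line_extension f i \<rho> B \<psi>" and \<delta>: "0 < \<delta>" "2 * (real k + 1) * \<delta> \<le> \<rho>" and h: "0 \<le> h" "h \<le> \<delta>"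
  shows "norm ((fdiff (axis i h) ^^ k) (\<lambda>\<psi>. of_real (f \<psi>)) \<psi>) \<le> (h / \<delta>) ^ k * B"
proof -
  obtain G where G: "G holomorphic_on ball 0 \<rho>" "\<And>z. z \<in> ball 0 \<rho> \<Longrightarrow> norm (G z) \<le> B"
    and Gf: "\<And>\<theta>. \<bar>\<theta>\<bar> < \<rho> \<Longrightarrow> G (of_real \<theta>) = of_real (f (\<psi> + axis i \<theta>))"
    using ext unfolding line_extension_def by blast
  \<comment> \<open>The k differences cost 2 k \<delta> of the radius; the surplus 2 \<delta> keeps
    the centre inside the ball.\<close>
  have k\<delta>: "2 * real k * \<delta> < \<rho>"
    using \<delta> by (simp add: algebra_simps)
  then have "norm ((fdiff (of_real h) ^^ k) G 0) \<le> (norm (of_real h :: complex) / \<delta>) ^ k * B"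
    using fdiff_bound[OF G \<delta>(1), of "of_real h" k] h by auto
  moreover have "real k * h \<le> real k * \<delta>"
    using h by (intro mult_left_mono) auto
  then have "real k * h < \<rho>"
    using k\<delta> \<delta> zero_le_mult_iff[of "real k" \<delta>] by linarith
  then have "(fdiff (of_real h) ^^ k) G 0 = (fdiff (axis i h) ^^ k) (\<lambda>\<psi>. of_real (f \<psi>)) \<psi>"
    using fdiff_line_extension[of \<rho> G f \<psi> i 0 h k, OF Gf] h by (simp add: axis_def flip: zero_vec_def)
  ultimately show ?thesis
    using h by simp
qed

text \<open>Convergence of the power series at the corner with all coordinates \<sigma> is absolute
  and hence dominates it on the complex polydisc of radius \<sigma>. Half of \<sigma> is spent on
  moving from \<open>p\<close> to \<psi>, half on the complex variable. The denominator d + 1 in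
  \<sigma> places the corner strictly inside the ball of radius r.\<close>

lemma local_line_extension:
  fixes f :: "real ^ 'd \<Rightarrow> real"
  assumes "real_analytic f"
  shows "\<exists>\<rho>>0. \<exists>B. \<forall>\<psi>\<in>ball p \<rho>. line_extension f i \<rho> B \<psi>"
proof -
  obtain c :: "nat ^ 'd \<Rightarrow> real" and r where r: "r > 0"
    and c: "\<And>h. norm h < r \<Longrightarrow> ((\<lambda>k. c k * (\<Prod>j\<in>UNIV. h $ j ^ (k $ j))) has_sum f (p + h)) UNIV"
    using assms unfolding real_analytic_def by metis
  define \<sigma> where "\<sigma> = r / (real CARD('d) + 1)"
  have \<sigma>: "\<sigma> > 0"
    using r by (simp add: \<sigma>_def)
  have small: "norm h < r" if "\<And>j. \<bar>h $ j\<bar> \<le> \<sigma>" for h :: "real ^ 'd"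
  proof -
    have "norm h \<le> (\<Sum>j\<in>(UNIV :: 'd set). \<sigma>)"
      by (rule order_trans[OF norm_le_l1_cart sum_mono]) (rule that)
    also have "\<dots> < r"
      using r by (simp add: \<sigma>_def field_simps)
    finally show ?thesis .
  qed
  define M where "M k = norm (c k * (\<Prod>j\<in>UNIV. \<sigma> ^ (k $ j)))" for k
  have M: "M summable_on UNIV"
  proof -
    have "norm ((\<chi> j. \<sigma>) :: real ^ 'd) < r"
      by (rule small) (use \<sigma> in simp)
    then have "(\<lambda>k. c k * (\<Prod>j\<in>UNIV. (\<chi> j. \<sigma>) $ j ^ (k $ j))) summable_on UNIV"
      by (rule has_sum_imp_summable[OF c])
    then show ?thesis
      unfolding M_def vec_lambda_beta by (rule summable_on_iff_abs_summable_on_real[THEN iffD1])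
  qed
  have M': "norm (of_real (c k) * (\<Prod>j\<in>UNIV. z j ^ (k $ j)) :: complex) \<le> M k"
    if "\<And>j. norm (z j) \<le> \<sigma>" for z k
  proof -
    have "norm (\<Prod>j\<in>UNIV. z j ^ (k $ j)) \<le> (\<Prod>j\<in>UNIV. \<sigma> ^ (k $ j))"
      unfolding prod_norm[symmetric] norm_power by (intro prod_mono) (auto intro!: power_mono that)
    then show ?thesis
      unfolding M_def using \<sigma> by (simp add: norm_mult abs_mult abs_prod mult_left_mono)
  qed
  have "line_extension f i (\<sigma> / 2) (infsum M UNIV) \<psi>" if \<psi>: "\<psi> \<in> ball p (\<sigma> / 2)" for \<psi>
  proof -
    define h where "h = \<psi> - p"
    have h: "\<bar>h $ j\<bar> < \<sigma> / 2" for j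
      using component_le_norm_cart[of h j] \<psi> by (simp add: h_def dist_norm norm_minus_commute)
    define \<zeta> :: "complex \<Rightarrow> 'd \<Rightarrow> complex" where "\<zeta> z j = of_real (h $ j) + (if j = i then z else 0)" for z j
    define G where "G z = (\<Sum>\<^sub>\<infinity>k. of_real (c k) * (\<Prod>j\<in>UNIV. \<zeta> z j ^ (k $ j)))" for z
    have \<zeta>: "norm (\<zeta> z j) \<le> \<sigma>" if "z \<in> ball 0 (\<sigma> / 2)" for z j
      using norm_triangle_ineq[of "of_real (h $ j)" z] h[of j] that \<sigma> by (auto simp: \<zeta>_def)
    have "G holomorphic_on ball 0 (\<sigma> / 2)"
      unfolding G_def
    proof (rule holomorphic_on_infsum[OF open_ball _ M' M])
      have "(\<lambda>z. \<zeta> z j) holomorphic_on ball 0 (\<sigma> / 2)" for j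
        unfolding \<zeta>_def by (cases "j = i") (auto intro!: holomorphic_intros)
      then show "(\<lambda>z. of_real (c k) * (\<Prod>j\<in>UNIV. \<zeta> z j ^ (k $ j))) holomorphic_on ball 0 (\<sigma> / 2)" for k
        by (intro holomorphic_intros)
    qed (rule \<zeta>)
    moreover have "norm (G z) \<le> infsum M UNIV" if "z \<in> ball 0 (\<sigma> / 2)" for z
    proof (rule norm_infsum_le[OF _ has_sum_infsum[OF M]])
      show "((\<lambda>k. of_real (c k) * (\<Prod>j\<in>UNIV. \<zeta> z j ^ (k $ j))) has_sum G z) UNIV"
        unfolding G_def
        by (rule has_sum_infsum, rule abs_summable_summable,
            rule Infinite_Sum.abs_summable_on_comparison_test'[OF M M'[OF \<zeta>[OF that]]])
    qed (rule M'[OF \<zeta>[OF that]])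
    moreover have "G (of_real \<theta>) = of_real (f (\<psi> + axis i \<theta>))" if "\<bar>\<theta>\<bar> < \<sigma> / 2" for \<theta>
    proof -
      have "((\<lambda>k. of_real (c k * (\<Prod>j\<in>UNIV. (h + axis i \<theta>) $ j ^ (k $ j))) :: complex) has_sum
          of_real (f (p + (h + axis i \<theta>)))) UNIV"
      proof (rule has_sum_of_real, rule c, rule small)
        show "\<bar>(h + axis i \<theta>) $ j\<bar> \<le> \<sigma>" for j
          using h[of j] that \<sigma> by (auto simp: axis_def)
      qed
      moreover have "\<zeta> (of_real \<theta>) j = of_real ((h + axis i \<theta>) $ j)" for j
        by (simp add: \<zeta>_def axis_def)
      ultimately show ?thesis
        by (simp add: G_def h_def infsumI)
    qed
    ultimately show ?thesis
      unfolding line_extension_def by blast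
  qed
  moreover have "0 < \<sigma> / 2"
    using \<sigma> by simp
  ultimately show ?thesis
    by blast
qed

lemma fourier_series_periodic:
  fixes F :: "real ^ 'd \<Rightarrow> complex"
  assumes F: "fourier_series F c"
  shows "F (\<psi> + (\<chi> j. 2 * pi * of_int (n $ j))) = F \<psi>"
proof -
  let ?\<eta> = "(\<chi> j. 2 * pi * of_int (n $ j)) :: real ^ 'd"
  have "exp (\<i> * of_real (int_inner \<nu> ?\<eta>)) = 1" for \<nu> :: "int ^ 'd"
  proof -
    define m where "m = (\<Sum>j\<in>UNIV. \<nu> $ j * n $ j)"
    have "int_inner \<nu> ?\<eta> = 2 * pi * of_int m"
      by (simp add: m_def int_inner_def sum_distrib_left mult_ac)
    then show ?thesis
      using exp_integer_2pi[of "of_int m"] by (simp add: mult_ac)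
  qed
  then have "fourier_series (\<lambda>\<psi>. F (\<psi> + ?\<eta>)) c"
    using fourier_series_shift[OF F, of ?\<eta>] by simp
  then show ?thesis
    using F unfolding fourier_series_def by (meson has_sum_unique)
qed

text \<open>Compactness: finitely many of the local balls cover the period box, and the smallest
  width and largest bound among them work there. Every other point is carried into the box by a
  lattice translation, under which f is invariant.\<close>

lemma uniform_line_extension:
  fixes f :: "real ^ 'd \<Rightarrow> real"
  assumes an: "real_analytic f" and fc: "has_fourier_coeffs f c"
  shows "\<exists>\<rho>>0. \<exists>B. \<forall>\<psi>. line_extension f i \<rho> B \<psi>"
proof -
  obtain \<rho> B where \<rho>: "\<And>p. \<rho> p > 0" and ext: "\<And>p \<psi>. \<psi> \<in> ball p (\<rho> p) \<Longrightarrow> line_extension f i (\<rho> p) (B p) \<psi>"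
  proof -
    have "\<forall>p. \<exists>\<rho> B. \<rho> > 0 \<and> (\<forall>\<psi>\<in>ball p \<rho>. line_extension f i \<rho> B \<psi>)"
      using local_line_extension[OF an] by blast
    then obtain \<rho> B where "\<forall>p. \<rho> p > 0 \<and> (\<forall>\<psi>\<in>ball p (\<rho> p). line_extension f i (\<rho> p) (B p) \<psi>)"
      unfolding choice_iff by blast
    then show thesis
      by (intro that[of \<rho> B]) auto
  qed
  let ?C = "cbox 0 (\<chi> j. 2 * pi) :: (real ^ 'd) set"
  have "?C \<subseteq> (\<Union>p\<in>?C. ball p (\<rho> p))"
    using \<rho> by (intro subsetI UN_I) auto
  then obtain D where D: "D \<subseteq> ?C" "finite D" "?C \<subseteq> (\<Union>p\<in>D. ball p (\<rho> p))"
    by (rule compactE_image[OF compact_cbox open_ball])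
  have "0 \<in> ?C"
    by (simp add: mem_box_cart)
  then have ne: "D \<noteq> {}"
    using D by auto
  define \<rho>' where "\<rho>' = Min (\<rho> ` D)"
  define B' where "B' = Max (B ` D)"
  have "line_extension f i \<rho>' B' \<psi>" for \<psi>
  proof -
    define n :: "int ^ 'd" where "n = (\<chi> j. \<lfloor>\<psi> $ j / (2 * pi)\<rfloor>)"
    define \<eta> :: "real ^ 'd" where "\<eta> = (\<chi> j. 2 * pi * of_int (n $ j))"
    have "0 \<le> (\<psi> - \<eta>) $ j \<and> (\<psi> - \<eta>) $ j \<le> 2 * pi" for j
    proof -
      have "of_int (n $ j) \<le> \<psi> $ j / (2 * pi)" "\<psi> $ j / (2 * pi) \<le> of_int (n $ j) + 1"
        unfolding n_def by (auto simp: real_of_int_floor_add_one_ge)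
      then show ?thesis
        by (simp add: \<eta>_def field_simps)
    qed
    then have "\<psi> - \<eta> \<in> ?C"
      by (simp add: mem_box_cart)
    then obtain p where p: "p \<in> D" "\<psi> - \<eta> \<in> ball p (\<rho> p)"
      using D by blast
    have "line_extension f i \<rho>' B' (\<psi> - \<eta>)"
      by (rule line_extension_mono[OF ext[OF p(2)]]) (simp_all add: \<rho>'_def B'_def p D)
    moreover have "f (\<psi> - \<eta> + axis i \<theta>) = f (\<psi> + axis i \<theta>)" for \<theta>
      using fourier_series_periodic[OF fc[unfolded has_fourier_coeffs_iff], of "\<psi> - \<eta> + axis i \<theta>" n]
      unfolding \<eta>_def[symmetric] by (simp add: algebra_simps)
    ultimately show ?thesis
      by (simp add: line_extension_def)
  qed
  moreover have "\<rho>' > 0"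
    using Min_in[of "\<rho> ` D"] D(2) ne \<rho> unfolding \<rho>'_def by fastforce
  ultimately show ?thesis
    by blast
qed

text \<open>The k-th difference with step h along axis i multiplies \<open>c \<nu>\<close> by a k-th
  power of exp (i a h) - 1 with a the i-th coordinate of \<nu>, and is bounded by
  \<open>(h / \<delta>) ^ k * B\<close>. Dividing by \<open>h ^ k\<close> and letting h decrease to
  0 leaves |a|^k.\<close>

lemma fourier_coeff_decay:
  fixes f :: "real ^ 'd \<Rightarrow> real"
  assumes an: "real_analytic f" and fc: "has_fourier_coeffs f c"
  shows "\<exists>M. \<forall>\<nu>. \<bar>of_int (\<nu> $ i)\<bar> ^ k * norm (c \<nu>) \<le> M"
proof -
  obtain \<rho> B where \<rho>: "\<rho> > 0" and ext: "\<And>\<psi>. line_extension f i \<rho> B \<psi>"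
    using uniform_line_extension[OF an fc] by blast
  define \<delta> where "\<delta> = \<rho> / (2 * (real k + 1))"
  have \<delta>: "0 < \<delta>" "2 * (real k + 1) * \<delta> \<le> \<rho>"
    using \<rho> by (simp_all add: \<delta>_def)
  have "\<bar>of_int (\<nu> $ i)\<bar> ^ k * norm (c \<nu>) \<le> B / \<delta> ^ k" for \<nu>
  proof -
    define a :: real where "a = of_int (\<nu> $ i)"
    let ?q = "\<lambda>h. (exp (\<i> * of_real (a * (0 + h))) - exp (\<i> * of_real (a * 0))) /\<^sub>R h"
    have "((\<lambda>z. exp (\<i> * (of_real a * z))) has_field_derivative \<i> * of_real a) (at (of_real 0))"
      by (rule derivative_eq_intros refl)+ simp
    from has_vector_derivative_real_field[OF this]
    have "((\<lambda>h. exp (\<i> * of_real (a * h))) has_vector_derivative \<i> * of_real a) (at 0)"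
      by simp
    then have "(?q \<longlongrightarrow> \<i> * of_real a) (at 0)"
      by (simp only: has_vector_derivative_iff_quotient)
    then have "(?q \<longlongrightarrow> \<i> * of_real a) (at_right 0)"
      by (rule tendsto_within_subset) simp
    then have "((\<lambda>h. norm (?q h) ^ k * norm (c \<nu>)) \<longlongrightarrow> norm (\<i> * of_real a) ^ k * norm (c \<nu>)) (at_right 0)"
      by (intro tendsto_intros)
    moreover have "\<forall>\<^sub>F h in at_right 0. norm (?q h) ^ k * norm (c \<nu>) \<le> B / \<delta> ^ k"
    proof (rule eventually_mono)
      show "\<forall>\<^sub>F h in at_right 0. 0 < h \<and> h < \<delta>"
        using \<delta> unfolding eventually_at_right_field by blast
      fix h :: real assume "0 < h \<and> h < \<delta>"
      then have h: "0 < h" "h \<le> \<delta>" by auto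
      have "norm ((exp (\<i> * of_real (int_inner \<nu> (axis i h))) - 1) ^ k * c \<nu>) \<le> (h / \<delta>) ^ k * B"
        using fourier_coeff_bound[OF fourier_series_fdiff[OF fc[unfolded has_fourier_coeffs_iff]]]
          fdiff_line_extension_bound[OF ext \<delta>, of h] h by auto
      moreover have "h * norm (?q h) = norm (exp (\<i> * of_real (int_inner \<nu> (axis i h))) - 1)"
        using h by (simp add: int_inner_axis a_def)
      ultimately have "(h * norm (?q h)) ^ k * norm (c \<nu>) \<le> h ^ k * (B / \<delta> ^ k)"
        by (simp add: norm_mult norm_power power_divide)
      then have "h ^ k * (norm (?q h) ^ k * norm (c \<nu>)) \<le> h ^ k * (B / \<delta> ^ k)"
        by (simp add: power_mult_distrib)
      then show "norm (?q h) ^ k * norm (c \<nu>) \<le> B / \<delta> ^ k"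
        using h by (subst (asm) mult_le_cancel_left_pos) auto
    qed
    ultimately have "norm (\<i> * of_real a) ^ k * norm (c \<nu>) \<le> B / \<delta> ^ k"
      by (rule tendsto_upperbound) simp
    then show ?thesis
      by (simp add: a_def norm_mult)
  qed
  then show ?thesis
    by blast
qed

section \<open>Summability over the integer lattice\<close>

lemma summable_inverse_squares_int: "(\<lambda>n::int. inverse (1 + (of_int n)\<^sup>2) :: real) summable_on UNIV"
proof -
  let ?w = "\<lambda>n::int. inverse (1 + (of_int n)\<^sup>2) :: real"
  have "summable (\<lambda>n. inverse ((real n)\<^sup>2))"
    using inverse_power_summable[of 2, where 'a = real] by simp
  then have "summable (\<lambda>n. inverse (1 + (real n)\<^sup>2))"
  proof (rule summable_comparison_test_ev[rotated])
    show "\<forall>\<^sub>F n in sequentially. norm (inverse (1 + (real n)\<^sup>2)) \<le> inverse ((real n)\<^sup>2)"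
      using eventually_gt_at_top[of 0] by eventually_elim (simp add: add_pos_nonneg)
  qed
  then have nat: "(\<lambda>n. inverse (1 + (real n)\<^sup>2)) summable_on UNIV"
    by (subst summable_on_UNIV_nonneg_real_iff) (auto intro: add_nonneg_nonneg)
  have "?w summable_on range int" "?w summable_on range (\<lambda>n. - int n)"
    using nat by (subst summable_on_reindex; simp add: inj_on_def o_def)+
  then have "?w summable_on (range int \<union> range (\<lambda>n. - int n))"
    by (rule summable_on_union)
  moreover have "range int \<union> range (\<lambda>n. - int n) = UNIV"
    by (auto simp: image_iff) (metis int_cases2)
  ultimately show ?thesis
    by simp
qed

text \<open>The sum factors into one-dimensional sums, lattice vectors being functions on a finite
  index set. The product rule used here concerns the other notion of absolute summability, hence the
  two conversions.\<close>

lemma summable_lattice_weight: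
  "(\<lambda>\<nu> :: int ^ 'd. \<Prod>j\<in>UNIV. inverse (1 + (of_int (\<nu> $ j))\<^sup>2) :: real) summable_on UNIV"
proof -
  let ?w = "\<lambda>n::int. inverse (1 + (of_int n)\<^sup>2) :: real"
  let ?p = "\<lambda>g :: 'd \<Rightarrow> int. \<Prod>j\<in>UNIV. ?w (g j)"
  have "?w abs_summable_on UNIV"
    using summable_inverse_squares_int by simp
  then have "Infinite_Set_Sum.abs_summable_on ?w UNIV"
    using abs_summable_equivalent by blast
  then have "Infinite_Set_Sum.abs_summable_on ?p (PiE UNIV (\<lambda>_. UNIV))"
    by (intro abs_summable_on_prod_PiE) auto
  then have "?p abs_summable_on UNIV"
    using abs_summable_equivalent[of ?p] by (simp add: PiE_UNIV_domain)
  then have "?p summable_on UNIV"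
    by (rule abs_summable_summable)
  moreover have "bij (vec_nth :: int ^ 'd \<Rightarrow> 'd \<Rightarrow> int)"
    by (rule bij_betwI[where g = vec_lambda]) auto
  ultimately show ?thesis
    using summable_on_reindex_bij_betw[of vec_nth UNIV UNIV ?p] by simp
qed

lemma fourier_coeffs_weighted_summable:
  fixes f :: "real ^ 'd \<Rightarrow> real"
  assumes an: "real_analytic f" and fc: "has_fourier_coeffs f c"
  shows "(\<lambda>\<nu>. of_int (int_l1_norm \<nu>) ^ m * norm (c \<nu>)) summable_on UNIV"
proof -
  let ?d = "CARD('d)"
  \<comment> \<open>Let a be the largest coordinate modulus of \<nu>. The l1 norm is at most d a,
    which costs m powers of a, and the product of the 1 + \<nu>_j^2 is at most (2 a^2)^d, which
    costs 2 d more.\<close>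
  let ?k = "m + 2 * ?d"
  obtain M where M: "\<And>i \<nu>. \<bar>of_int (\<nu> $ i)\<bar> ^ ?k * norm (c \<nu>) \<le> M i"
  proof -
    have "\<forall>i. \<exists>M. \<forall>\<nu>. \<bar>of_int (\<nu> $ i)\<bar> ^ ?k * norm (c \<nu>) \<le> M"
      using fourier_coeff_decay[OF an fc] by blast
    then show thesis
      unfolding choice_iff using that by blast
  qed
  define M' where "M' = norm (c 0) + real ?d ^ m * 2 ^ ?d * (\<Sum>i\<in>UNIV. M i)"
  have M0: "0 \<le> M i" for i
    using M[of 0 i] by (meson abs_ge_zero mult_nonneg_nonneg norm_ge_zero order_trans zero_le_power)
  have "of_int (int_l1_norm \<nu>) ^ m * norm (c \<nu>) \<le> M' * (\<Prod>j\<in>UNIV. inverse (1 + (of_int (\<nu> $ j))\<^sup>2))" for \<nu>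
  proof (cases "\<nu> = 0")
    case True
    \<comment> \<open>For m = 0 this is an equality because 0^0 = 1, which is why \<open>M'\<close>
      contains \<open>norm (c 0)\<close>.\<close>
    have "(0::real) ^ m * norm (c 0) \<le> norm (c 0)"
      by (cases m) auto
    then show ?thesis
      using True M0 by (simp add: int_l1_norm_def M'_def sum_nonneg add_increasing2)
  next
    case False
    define i where "i = (SOME i. \<forall>j. \<bar>\<nu> $ j\<bar> \<le> \<bar>\<nu> $ i\<bar>)"
    have "\<exists>i. \<forall>j. \<bar>\<nu> $ j\<bar> \<le> \<bar>\<nu> $ i\<bar>"
    proof -
      have "Max (range (\<lambda>j. \<bar>\<nu> $ j\<bar>)) \<in> range (\<lambda>j. \<bar>\<nu> $ j\<bar>)"
        by (rule Max_in) auto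
      then obtain i where "Max (range (\<lambda>j. \<bar>\<nu> $ j\<bar>)) = \<bar>\<nu> $ i\<bar>"
        by (rule imageE)
      then have "\<bar>\<nu> $ j\<bar> \<le> \<bar>\<nu> $ i\<bar>" for j
        using Max_ge[of "range (\<lambda>j. \<bar>\<nu> $ j\<bar>)" "\<bar>\<nu> $ j\<bar>"] by simp
      then show ?thesis
        by blast
    qed
    then have i: "\<bar>\<nu> $ j\<bar> \<le> \<bar>\<nu> $ i\<bar>" for j
      unfolding i_def by (rule someI2_ex) blast
    define a :: real where "a = \<bar>of_int (\<nu> $ i)\<bar>"
    have ia: "\<bar>real_of_int (\<nu> $ j)\<bar> \<le> a" for j
      using i[of j] unfolding a_def by linarith
    have "\<nu> $ i \<noteq> 0"
      using False i by (metis abs_le_zero_iff abs_zero vec_eq_iff zero_index)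
    then have a: "1 \<le> a"
      unfolding a_def by linarith
    have "of_int (int_l1_norm \<nu>) \<le> (\<Sum>j\<in>(UNIV :: 'd set). a)"
      unfolding int_l1_norm_def of_int_sum by (rule sum_mono) (use ia in simp)
    then have l1: "real_of_int (int_l1_norm \<nu>) ^ m \<le> (real ?d * a) ^ m"
      by (intro power_mono) (auto simp: int_l1_norm_def sum_nonneg)
    have pr: "(\<Prod>j\<in>UNIV. 1 + (real_of_int (\<nu> $ j))\<^sup>2) \<le> (\<Prod>j\<in>(UNIV :: 'd set). 2 * a\<^sup>2)"
    proof (rule prod_mono)
      fix j
      have "(real_of_int (\<nu> $ j))\<^sup>2 \<le> a\<^sup>2"
        using power_mono[OF ia[of j], of 2] by simp
      moreover have "1 \<le> a\<^sup>2"
        using a by simp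
      ultimately show "0 \<le> 1 + (real_of_int (\<nu> $ j))\<^sup>2 \<and> 1 + (real_of_int (\<nu> $ j))\<^sup>2 \<le> 2 * a\<^sup>2"
        by (simp add: add_nonneg_nonneg)
    qed
    have pos: "0 < (\<Prod>j\<in>UNIV. 1 + (real_of_int (\<nu> $ j))\<^sup>2)"
      by (rule prod_pos) (simp add: add_pos_nonneg)
    have "of_int (int_l1_norm \<nu>) ^ m * norm (c \<nu>) * (\<Prod>j\<in>UNIV. 1 + (real_of_int (\<nu> $ j))\<^sup>2)
        \<le> (real ?d * a) ^ m * norm (c \<nu>) * (2 * a\<^sup>2) ^ ?d"
      using l1 pr pos a by (intro mult_mono) auto
    also have "\<dots> = real ?d ^ m * 2 ^ ?d * (a ^ ?k * norm (c \<nu>))"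
      unfolding power_add power_mult power_mult_distrib by (simp only: mult_ac)
    also have "\<dots> \<le> real ?d ^ m * 2 ^ ?d * (\<Sum>i\<in>UNIV. M i)"
      using M[of \<nu> i] member_le_sum[of i UNIV M] M0 unfolding a_def by (intro mult_left_mono) (auto intro: order_trans)
    also have "\<dots> \<le> M'"
      by (simp add: M'_def)
    finally have "of_int (int_l1_norm \<nu>) ^ m * norm (c \<nu>) \<le> M' / (\<Prod>j\<in>UNIV. 1 + (real_of_int (\<nu> $ j))\<^sup>2)"
      by (simp only: pos_le_divide_eq[OF pos])
    then show ?thesis
      using prod_inversef[of "\<lambda>j. 1 + (real_of_int (\<nu> $ j))\<^sup>2" UNIV] by (simp add: divide_inverse)
  qed
  then show ?thesis
    by (intro summable_on_comparison_test[OF summable_on_cmult_right[OF summable_lattice_weight, of M']])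
      (auto simp: int_l1_norm_def sum_nonneg)
qed

text \<open>The Diophantine condition bounds 1/s^2 by a multiple of the power 2 \<tau> of the l1
  norm, which the decay of the coefficients absorbs after rounding up to an integer power. At index
  0 division by zero gives 0, so the weight there is 1.\<close>

lemma small_divisor_weight_summable:
  fixes f :: "real ^ 'd \<Rightarrow> real"
  assumes an: "real_analytic f" and fc: "has_fourier_coeffs f c"
    and dio: "diophantine C\<^sub>0 \<tau> \<omega>" and C: "C\<^sub>0 > 0"
  shows "(\<lambda>\<nu>. (1 + 1 / (int_inner \<nu> \<omega>)\<^sup>2) * norm (c \<nu>)) summable_on UNIV"
proof -
  define m where "m = nat \<lceil>2 * \<tau>\<rceil>"
  let ?L = "\<lambda>\<nu>. real_of_int (int_l1_norm \<nu>)"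
  have "(\<lambda>\<nu>. ?L \<nu> ^ 0 * norm (c \<nu>) + 1 / C\<^sub>0\<^sup>2 * (?L \<nu> ^ m * norm (c \<nu>))) summable_on UNIV"
    by (intro summable_on_add summable_on_cmult_right fourier_coeffs_weighted_summable[OF an fc])
  then show ?thesis
  proof (rule summable_on_comparison_test)
    fix \<nu> :: "int ^ 'd"
    have "1 / (int_inner \<nu> \<omega>)\<^sup>2 \<le> 1 / C\<^sub>0\<^sup>2 * ?L \<nu> ^ m"
    proof (cases "\<nu> = 0")
      case True
      then show ?thesis
        by (simp add: int_l1_norm_def)
    next
      case False
      then obtain j where "\<nu> $ j \<noteq> 0"
        by (auto simp: vec_eq_iff)
      then have "1 \<le> \<bar>\<nu> $ j\<bar>"
        by linarith
      also have "\<dots> \<le> int_l1_norm \<nu>"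
        unfolding int_l1_norm_def by (rule member_le_sum) auto
      finally have L: "1 \<le> ?L \<nu>"
        by simp
      have "(?L \<nu> powr (- \<tau>))\<^sup>2 = ?L \<nu> powr (- (2 * \<tau>))"
        by (simp add: power2_eq_square flip: powr_add)
      moreover have "(C\<^sub>0 * ?L \<nu> powr (- \<tau>))\<^sup>2 \<le> \<bar>int_inner \<nu> \<omega>\<bar>\<^sup>2"
        using dio False C unfolding diophantine_def by (intro power_mono) auto
      ultimately have "C\<^sub>0\<^sup>2 * ?L \<nu> powr (- (2 * \<tau>)) \<le> (int_inner \<nu> \<omega>)\<^sup>2"
        by (simp add: power_mult_distrib)
      moreover have "0 < C\<^sub>0\<^sup>2 * ?L \<nu> powr (- (2 * \<tau>))"
        using C L by simp
      ultimately have "1 / (int_inner \<nu> \<omega>)\<^sup>2 \<le> 1 / (C\<^sub>0\<^sup>2 * ?L \<nu> powr (- (2 * \<tau>)))"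
        by (intro frac_le) auto
      also have "\<dots> = 1 / C\<^sub>0\<^sup>2 * ?L \<nu> powr (2 * \<tau>)"
        using L by (simp add: powr_minus field_simps)
      also have "?L \<nu> powr (2 * \<tau>) \<le> ?L \<nu> powr real m"
        using L by (intro powr_mono) (auto simp: m_def real_nat_ceiling_ge)
      also have "\<dots> = ?L \<nu> ^ m"
        using L by (simp add: powr_realpow)
      finally show ?thesis
        by (simp add: mult_left_mono divide_right_mono)
    qed
    from mult_right_mono[OF this norm_ge_zero[of "c \<nu>"]]
    show "(1 + 1 / (int_inner \<nu> \<omega>)\<^sup>2) * norm (c \<nu>) \<le> ?L \<nu> ^ 0 * norm (c \<nu>) + 1 / C\<^sub>0\<^sup>2 * (?L \<nu> ^ m * norm (c \<nu>))"
      by (simp add: distrib_right)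
    show "0 \<le> (1 + 1 / (int_inner \<nu> \<omega>)\<^sup>2) * norm (c \<nu>)"
      by (simp add: add_nonneg_nonneg)
  qed
qed

section \<open>The response solution\<close>

text \<open>Off the real axis, lowering l slightly makes the slope inequality strict without
  violating the strict radius bound; on the real axis it is already strict because \<epsilon> is not
  0. The radius bound also forces l > 0.\<close>

lemma punctured_D_dom_covered:
  assumes "\<epsilon> \<in> D_dom R - {0}"
  obtains l where "0 < l" "l \<le> 1" "\<epsilon> \<in> sector R l"
proof -
  from assms obtain l where l: "0 \<le> l" "l \<le> 1" "norm \<epsilon> < l * R" "l * \<bar>Im \<epsilon>\<bar> \<le> \<bar>Re \<epsilon>\<bar>" and e: "\<epsilon> \<noteq> 0"
    by (auto simp: D_dom_def D_part_def)
  have "0 < l * R"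
    using l(3) norm_ge_zero[of \<epsilon>] by linarith
  then have l0: "0 < l" and R: "0 < R"
    using l(1) by (auto simp: zero_less_mult_iff)
  show thesis
  proof (cases "Im \<epsilon> = 0")
    case True
    then have "\<epsilon> \<in> sector R l"
      using l e by (auto simp: sector_def complex_eq_iff)
    then show ?thesis
      using that l0 l by blast
  next
    case False
    obtain l' where l': "norm \<epsilon> / R < l'" "l' < l"
      using l(3) R dense[of "norm \<epsilon> / R" l] by (auto simp: field_simps)
    have "0 < l'"
      using l'(1) R by (meson divide_nonneg_pos norm_ge_zero order_le_less_trans)
    moreover have "l' * \<bar>Im \<epsilon>\<bar> < l * \<bar>Im \<epsilon>\<bar>"
      using l' False by simp
    then have "\<epsilon> \<in> sector R l'"
      using l' l R by (auto simp: sector_def field_simps)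
    ultimately show ?thesis
      using that l' l by force
  qed
qed

text \<open>\<open>c\<close> stands for the coefficients of f - \<alpha> and \<open>s \<nu>\<close>
  for the frequencies. \<open>R_small\<close> is the condition 4 K W \<le> 1 of
  \<open>majorant\<close> for K = 4/(\<kappa> l) and W the total of \<open>weight l\<close>: the
  factor l in the weight cancels the one in K.\<close>

locale damped_response =
  fixes s :: "'g::ab_group_add \<Rightarrow> real" and c :: "'g \<Rightarrow> complex" and \<kappa> R :: real
  assumes s_add: "s (\<mu> + \<nu>) = s \<mu> + s \<nu>" and s_nonzero: "\<nu> \<noteq> 0 \<Longrightarrow> s \<nu> \<noteq> 0"
    and c_zero: "c 0 = 0" and c_cnj: "cnj (c \<nu>) = c (- \<nu>)"
    and \<kappa>: "0 < \<kappa>" and R: "0 < R" "R \<le> 1" "R\<^sup>2 * \<kappa> \<le> 1"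
    and weighted: "(\<lambda>\<nu>. (1 + 1 / (s \<nu>)\<^sup>2) * norm (c \<nu>)) summable_on UNIV"
    and R_small: "16 * R * (16 + 256 * \<kappa>) * (\<Sum>\<^sub>\<infinity>\<nu>. (1 + 1 / (s \<nu>)\<^sup>2) * norm (c \<nu>)) \<le> \<kappa>"
begin

definition inv_div :: "complex \<Rightarrow> 'g \<Rightarrow> complex" where "inv_div \<epsilon> \<nu> = 1 / divisor \<kappa> (s \<nu>) \<epsilon>"

definition response :: "complex \<Rightarrow> 'g \<Rightarrow> complex"
  where "response \<epsilon> = qlim (inv_div \<epsilon>) (\<lambda>\<nu>. inv_div \<epsilon> \<nu> * c \<nu>)"

definition weight :: "real \<Rightarrow> 'g \<Rightarrow> real"
  where "weight l \<nu> = l * R * (16 + 256 * \<kappa>) * ((1 + 1 / (s \<nu>)\<^sup>2) * norm (c \<nu>))"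

lemma s_zero: "s 0 = 0"
  using s_add[of 0 0] by simp

lemma s_minus: "s (- \<nu>) = - s \<nu>"
  using s_add[of \<nu> "- \<nu>"] s_zero by simp

lemma divisor_nonzero:
  assumes "0 < l" "l \<le> 1" "\<epsilon> \<in> sector R l"
  shows "divisor \<kappa> (s \<nu>) \<epsilon> \<noteq> 0"
proof
  assume "divisor \<kappa> (s \<nu>) \<epsilon> = 0"
  then have "\<kappa> * l / 4 \<le> 0"
    using divisor_lower_bound[OF assms(3,1,2) \<kappa> R(3), of "s \<nu>"] by simp
  then show False
    using \<kappa> assms(1) by (simp add: mult_le_0_iff)
qed

lemma majorant_weight:
  assumes l: "0 < l" "l \<le> 1"
  shows "majorant (weight l) (4 / (\<kappa> * l))"
proof
  have lR: "0 \<le> l * R * (16 + 256 * \<kappa>)"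
    using l R \<kappa> by simp
  show "0 \<le> weight l \<nu>" for \<nu>
    unfolding weight_def by (rule mult_nonneg_nonneg[OF lR]) (simp add: add_nonneg_nonneg)
  show "weight l summable_on UNIV"
    unfolding weight_def by (rule summable_on_cmult_right[OF weighted])
  show "0 \<le> 4 / (\<kappa> * l)"
    using l \<kappa> by simp
  let ?W = "\<Sum>\<^sub>\<infinity>\<nu>. (1 + 1 / (s \<nu>)\<^sup>2) * norm (c \<nu>)"
  have "4 * (4 / (\<kappa> * l)) * infsum (weight l) UNIV = 16 * R * (16 + 256 * \<kappa>) * ?W / \<kappa>"
    unfolding weight_def infsum_cmult_right' using l \<kappa> by (simp add: field_simps)
  also have "\<dots> \<le> 1"
    using R_small \<kappa> by simp
  finally show "4 * (4 / (\<kappa> * l)) * infsum (weight l) UNIV \<le> 1" .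
qed

lemma majorized_response:
  assumes l: "0 < l" "l \<le> 1" and e: "\<epsilon> \<in> sector R l"
  shows "majorized (weight l) (4 / (\<kappa> * l)) (inv_div \<epsilon>) (\<lambda>\<nu>. inv_div \<epsilon> \<nu> * c \<nu>)"
proof (intro majorized.intro majorant_weight l majorized_axioms.intro)
  fix \<nu>
  have "0 < \<kappa> * l / 4"
    using \<kappa> l by simp
  moreover note divisor_lower_bound[OF e l \<kappa> R(3), of "s \<nu>"]
  ultimately have "1 / norm (divisor \<kappa> (s \<nu>) \<epsilon>) \<le> 1 / (\<kappa> * l / 4)"
    by (intro divide_left_mono mult_pos_pos) auto
  then show "norm (inv_div \<epsilon> \<nu>) \<le> 4 / (\<kappa> * l)"
    by (simp add: inv_div_def norm_divide)
  \<comment> \<open>Index 0 is separate: its inverse divisor is 1/\<kappa>, with no factor l, and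
    only \<open>c_zero\<close> saves the bound.\<close>
  show "norm (inv_div \<epsilon> \<nu> * c \<nu>) \<le> weight l \<nu>"
  proof (cases "\<nu> = 0")
    case True
    then show ?thesis
      by (simp add: c_zero weight_def)
  next
    case False
    have "norm (inv_div \<epsilon> \<nu>) * norm (c \<nu>) \<le> l * R * ((16 + 256 * \<kappa>) * (1 + 1 / (s \<nu>)\<^sup>2)) * norm (c \<nu>)"
      unfolding inv_div_def
      by (intro mult_right_mono inverse_divisor_bound[OF e l \<kappa> R(3,2) s_nonzero[OF False]]) simp
    then show ?thesis
      by (simp add: weight_def norm_mult mult.assoc)
  qed
qed

lemma response_abs_summable:
  assumes "0 < l" "l \<le> 1" "\<epsilon> \<in> sector R l"
  shows "response \<epsilon> abs_summable_on UNIV"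
  unfolding response_def by (rule majorized.qlim_abs_summable[OF majorized_response[OF assms]])

lemma response_equation:
  assumes "0 < l" "l \<le> 1" "\<epsilon> \<in> sector R l"
  shows "divisor \<kappa> (s \<nu>) \<epsilon> * response \<epsilon> \<nu> = c \<nu> - conv (response \<epsilon>) (response \<epsilon>) \<nu>"
proof -
  have "response \<epsilon> \<nu> = inv_div \<epsilon> \<nu> * (c \<nu> - conv (response \<epsilon>) (response \<epsilon>) \<nu>)"
    using majorized.qlim_fixed_point[OF majorized_response[OF assms], of \<nu>]
    by (simp add: response_def right_diff_distrib)
  then show ?thesis
    using divisor_nonzero[OF assms, of \<nu>] by (simp add: inv_div_def)
qed

lemma response_sum_holomorphic:
  assumes l: "0 < l" "l \<le> 1"
  shows "(\<lambda>\<epsilon>. \<Sum>\<^sub>\<infinity>\<nu>. exp (\<i> * of_real (s \<nu> * t)) * response \<epsilon> \<nu>) holomorphic_on sector R l"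
proof (rule holomorphic_on_infsum[OF open_sector])
  interpret majorant "weight l" "4 / (\<kappa> * l)"
    by (rule majorant_weight[OF l])
  show "Vlim summable_on UNIV"
    by (rule Vlim_summable)
  have inv: "(\<lambda>\<epsilon>. inv_div \<epsilon> \<nu>) holomorphic_on sector R l" for \<nu>
    unfolding inv_div_def
  proof (intro holomorphic_on_divide holomorphic_on_const)
    show "divisor \<kappa> (s \<nu>) holomorphic_on sector R l"
      unfolding divisor_def[abs_def] by (intro holomorphic_intros) (rule sector_nonzero)
  qed (rule divisor_nonzero[OF l])
  have "(\<lambda>\<epsilon>. response \<epsilon> \<nu>) holomorphic_on sector R l" for \<nu>
    unfolding response_def
    by (rule qlim_holomorphic[OF open_sector majorized_response[OF l]]) (auto intro!: holomorphic_intros inv)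
  then show "(\<lambda>\<epsilon>. exp (\<i> * of_real (s \<nu> * t)) * response \<epsilon> \<nu>) holomorphic_on sector R l" for \<nu>
    by (intro holomorphic_on_mult holomorphic_on_const)
  show "norm (exp (\<i> * of_real (s \<nu> * t)) * response \<epsilon> \<nu>) \<le> Vlim \<nu>" if "\<epsilon> \<in> sector R l" for \<nu> \<epsilon>
    using majorized.qlim_le[OF majorized_response[OF l that], of \<nu>] by (simp add: response_def norm_mult)
qed

section \<open>Real \<epsilon>: reality, two derivatives and the differential equation\<close>

context
  fixes e :: real
  assumes e: "e \<noteq> 0" "\<bar>e\<bar> < R"
begin

lemma real_in_sector: "complex_of_real e \<in> sector R 1"
  using e by (simp add: sector_def)

abbreviation u :: "'g \<Rightarrow> complex" where "u \<equiv> response (of_real e)"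

lemmas u_abs_summable = response_abs_summable[OF zero_less_one order_refl real_in_sector]
lemmas u_equation = response_equation[OF zero_less_one order_refl real_in_sector]

lemma cnj_u: "cnj (u \<nu>) = u (- \<nu>)"
proof -
  let ?T = "inv_div (of_real e)" and ?A = "\<lambda>\<nu>. inv_div (of_real e) \<nu> * c \<nu>"
  have T: "cnj (?T \<nu>) = ?T (- \<nu>)" for \<nu>
    by (simp add: inv_div_def cnj_divisor s_minus)
  have lim: "(\<lambda>n. qiter ?T ?A n \<nu>) \<longlonglongrightarrow> u \<nu>" for \<nu>
    unfolding response_def
    by (rule majorized.qiter_tendsto[OF majorized_response[OF zero_less_one order_refl real_in_sector]])
  have "(\<lambda>n. cnj (qiter ?T ?A n \<nu>)) \<longlonglongrightarrow> cnj (u \<nu>)"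
    by (intro tendsto_intros lim)
  moreover have "cnj (qiter ?T ?A n \<nu>) = qiter ?T ?A n (- \<nu>)" for n
    by (rule cnj_qiter) (simp_all add: T c_cnj)
  ultimately show ?thesis
    using LIMSEQ_unique lim[of "- \<nu>"] by simp
qed

lemma c_abs_summable: "c abs_summable_on UNIV"
  by (rule Infinite_Sum.abs_summable_on_comparison_test'[OF weighted]) (simp add: distrib_right)

text \<open>Regularity is read off from the equation: s^2 u is the bounded multiplier s^2 / D
  applied to c - u * u, which is absolutely summable. The 1/4 in \<open>?C\<close> comes from
  \<open>divisor_lower_bound\<close> at l = 1.\<close>

lemma square_u_abs_summable: "(\<lambda>\<nu>. of_real ((s \<nu>)\<^sup>2) * u \<nu>) abs_summable_on UNIV"
proof (rule Infinite_Sum.abs_summable_on_comparison_test')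
  let ?C = "2 + 2 * \<kappa> / (\<kappa> * 1 / 4)"
  show "(\<lambda>\<nu>. ?C * (norm (c \<nu>) + norm (conv u u \<nu>))) summable_on UNIV"
    by (intro summable_on_cmult_right summable_on_add c_abs_summable conv_abs_summable u_abs_summable)
  fix \<nu>
  let ?D = "divisor \<kappa> (s \<nu>) (of_real e)"
  have D: "?D \<noteq> 0"
    by (rule divisor_nonzero[OF zero_less_one order_refl real_in_sector])
  have "norm ((s \<nu>)\<^sup>2 / ?D) \<le> ?C"
    using square_over_divisor_bound[OF e(1) \<kappa> _
        divisor_lower_bound[OF real_in_sector zero_less_one order_refl \<kappa> R(3)]] \<kappa>
    by simp
  moreover have "norm (c \<nu> - conv u u \<nu>) \<le> norm (c \<nu>) + norm (conv u u \<nu>)"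
    by (rule norm_triangle_ineq4)
  ultimately have "norm ((s \<nu>)\<^sup>2 / ?D) * norm (c \<nu> - conv u u \<nu>) \<le> ?C * (norm (c \<nu>) + norm (conv u u \<nu>))"
    using \<kappa> by (intro mult_mono) auto
  moreover have "of_real ((s \<nu>)\<^sup>2) * u \<nu> = (s \<nu>)\<^sup>2 / ?D * (c \<nu> - conv u u \<nu>)"
    using D unfolding u_equation[symmetric] by simp
  ultimately show "norm (of_real ((s \<nu>)\<^sup>2) * u \<nu>) \<le> ?C * (norm (c \<nu>) + norm (conv u u \<nu>))"
    by (simp only: norm_mult)
qed

lemma s_u_abs_summable: "(\<lambda>\<nu>. of_real (s \<nu>) * u \<nu>) abs_summable_on UNIV"
proof (rule Infinite_Sum.abs_summable_on_comparison_test')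
  show "(\<lambda>\<nu>. norm (u \<nu>) + norm (of_real ((s \<nu>)\<^sup>2) * u \<nu>)) summable_on UNIV"
    by (intro summable_on_add u_abs_summable square_u_abs_summable)
  fix \<nu>
  have "\<bar>s \<nu>\<bar> \<le> 1 + (s \<nu>)\<^sup>2"
  proof -
    have "0 \<le> (\<bar>s \<nu>\<bar> - 1)\<^sup>2" "0 \<le> \<bar>s \<nu>\<bar>"
      by simp_all
    then show ?thesis
      unfolding power2_diff power2_abs by simp
  qed
  from mult_right_mono[OF this norm_ge_zero[of "u \<nu>"]]
  show "norm (of_real (s \<nu>) * u \<nu>) \<le> norm (u \<nu>) + norm (of_real ((s \<nu>)\<^sup>2) * u \<nu>)"
    by (simp add: norm_mult norm_power distrib_right)
qed

abbreviation E :: "real \<Rightarrow> 'g \<Rightarrow> complex" where "E t \<nu> \<equiv> exp (\<i> * of_real (s \<nu> * t))"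

definition S0 :: "real \<Rightarrow> complex" where "S0 t = (\<Sum>\<^sub>\<infinity>\<nu>. E t \<nu> * u \<nu>)"
definition S1 :: "real \<Rightarrow> complex" where "S1 t = (\<Sum>\<^sub>\<infinity>\<nu>. E t \<nu> * (\<i> * of_real (s \<nu>) * u \<nu>))"
definition S2 :: "real \<Rightarrow> complex"
  where "S2 t = (\<Sum>\<^sub>\<infinity>\<nu>. E t \<nu> * (\<i> * of_real (s \<nu>) * (\<i> * of_real (s \<nu>) * u \<nu>)))"

lemma iu_abs_summable: "(\<lambda>\<nu>. \<i> * of_real (s \<nu>) * u \<nu>) abs_summable_on UNIV"
  "(\<lambda>\<nu>. of_real (s \<nu>) * (\<i> * of_real (s \<nu>) * u \<nu>)) abs_summable_on UNIV"
  using s_u_abs_summable square_u_abs_summable by (simp_all add: norm_mult power2_eq_square mult_ac abs_mult)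

lemma S0_deriv: "(S0 has_vector_derivative S1 t) (at t)"
  unfolding S0_def[abs_def] S1_def by (rule trig_sum_has_vector_derivative[OF u_abs_summable s_u_abs_summable])

lemma S1_deriv: "(S1 has_vector_derivative S2 t) (at t)"
  unfolding S1_def[abs_def] S2_def by (rule trig_sum_has_vector_derivative[OF iu_abs_summable])

lemma S0_real: "of_real (Re (S0 t)) = S0 t"
proof -
  have "cnj (S0 t) = (\<Sum>\<^sub>\<infinity>\<nu>. E t (- \<nu>) * u (- \<nu>))"
    unfolding S0_def infsum_cnj[symmetric] by (simp add: cnj_u exp_cnj s_minus)
  also have "\<dots> = S0 t"
    unfolding S0_def by (rule infsum_reindex_bij_betw[OF bij_uminus, of "\<lambda>\<nu>. E t \<nu> * u \<nu>"])
  finally show ?thesis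
    by (simp add: complex_eq_iff)
qed

text \<open>The differential equation for x = sqrt \<alpha> + S0 with \<alpha> moved to the right,
  since \<kappa> S0 + S0^2 is x^2 - \<alpha>. It is the coefficient equation times e, summed against
  the characters.\<close>

lemma S_equation:
  "of_real e * S2 t + S1 t + of_real e * (of_real \<kappa> * S0 t + (S0 t)\<^sup>2) = of_real e * (\<Sum>\<^sub>\<infinity>\<nu>. E t \<nu> * c \<nu>)"
proof -
  have E: "(\<lambda>\<nu>. E t \<nu> * a \<nu>) summable_on UNIV" if "a abs_summable_on UNIV" for a
    by (rule abs_summable_summable) (use that in \<open>simp add: norm_mult\<close>)
  have i2: "(\<lambda>\<nu>. \<i> * of_real (s \<nu>) * (\<i> * of_real (s \<nu>) * u \<nu>)) abs_summable_on UNIV"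
    using square_u_abs_summable by (simp add: norm_mult power2_eq_square mult_ac abs_mult)
  have sq: "(S0 t)\<^sup>2 = (\<Sum>\<^sub>\<infinity>\<nu>. E t \<nu> * conv u u \<nu>)"
    unfolding S0_def power2_eq_square using trig_sum_mult[OF u_abs_summable u_abs_summable s_add] by simp
  note hs = has_sum_infsum[OF E]
  have "((\<lambda>\<nu>. of_real e * (E t \<nu> * (\<i> * of_real (s \<nu>) * (\<i> * of_real (s \<nu>) * u \<nu>)))
       + E t \<nu> * (\<i> * of_real (s \<nu>) * u \<nu>)
       + of_real e * (of_real \<kappa> * (E t \<nu> * u \<nu>) + E t \<nu> * conv u u \<nu>)) has_sum
      (of_real e * S2 t + S1 t + of_real e * (of_real \<kappa> * S0 t + (S0 t)\<^sup>2))) UNIV"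
    unfolding sq unfolding S0_def S1_def S2_def
    by (intro has_sum_add has_sum_cmult_right hs i2 iu_abs_summable u_abs_summable conv_abs_summable)
  moreover have "of_real e * (E t \<nu> * (\<i> * of_real (s \<nu>) * (\<i> * of_real (s \<nu>) * u \<nu>)))
       + E t \<nu> * (\<i> * of_real (s \<nu>) * u \<nu>)
       + of_real e * (of_real \<kappa> * (E t \<nu> * u \<nu>) + E t \<nu> * conv u u \<nu>) = of_real e * (E t \<nu> * c \<nu>)" for \<nu>
  proof -
    have "of_real e * c \<nu> = of_real e * (divisor \<kappa> (s \<nu>) (of_real e) * u \<nu> + conv u u \<nu>)"
      by (simp add: u_equation)
    also have "of_real e * divisor \<kappa> (s \<nu>) (of_real e) =
        of_real e * of_real \<kappa> + of_real e * (\<i> * of_real (s \<nu>))\<^sup>2 + \<i> * of_real (s \<nu>)"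
      using e(1) by (simp add: divisor_def distrib_left right_diff_distrib power_mult_distrib)
    then have "of_real e * (divisor \<kappa> (s \<nu>) (of_real e) * u \<nu> + conv u u \<nu>) =
        (of_real e * of_real \<kappa> + of_real e * (\<i> * of_real (s \<nu>))\<^sup>2 + \<i> * of_real (s \<nu>)) * u \<nu> + of_real e * conv u u \<nu>"
      by (simp only: distrib_left mult.assoc[symmetric])
    finally have "E t \<nu> * (of_real e * c \<nu>) = E t \<nu> * \<dots>"
      by simp
    then show ?thesis
      by (simp add: algebra_simps power2_eq_square)
  qed
  ultimately have "((\<lambda>\<nu>. of_real e * (E t \<nu> * c \<nu>)) has_sum
      (of_real e * S2 t + S1 t + of_real e * (of_real \<kappa> * S0 t + (S0 t)\<^sup>2))) UNIV"
    by simp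
  moreover have "((\<lambda>\<nu>. of_real e * (E t \<nu> * c \<nu>)) has_sum of_real e * (\<Sum>\<^sub>\<infinity>\<nu>. E t \<nu> * c \<nu>)) UNIV"
    by (rule has_sum_cmult_right[OF hs[OF c_abs_summable]])
  ultimately show ?thesis
    by (rule has_sum_unique)
qed

end

end

section \<open>Choice of the radius and the conclusion\<close>

lemma quasi_periodic_offset_sum:
  assumes c: "c abs_summable_on UNIV"
    and x: "\<And>t. x t = a + (\<Sum>\<^sub>\<infinity>\<nu>. exp (\<i> * of_real (int_inner \<nu> \<omega> * t)) * c \<nu>)"
  shows "quasi_periodic \<omega> x"
proof -
  let ?d = "\<lambda>\<nu> :: int ^ 'a. if \<nu> = 0 then a else 0"
  have d: "(\<lambda>\<nu>. norm (?d \<nu>)) summable_on UNIV"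
    by (rule finite_nonzero_values_imp_summable_on) (auto intro: finite_subset[of _ "{0}"])
  have "(\<lambda>\<nu>. norm (?d \<nu> + c \<nu>)) summable_on UNIV"
    by (rule Infinite_Sum.abs_summable_on_comparison_test'[OF summable_on_add[OF d c] norm_triangle_ineq])
  moreover have "((\<lambda>\<nu>. exp (\<i> * of_real (int_inner \<nu> \<omega> * t)) * (?d \<nu> + c \<nu>)) has_sum x t) UNIV" for t
  proof -
    have "((\<lambda>\<nu>. exp (\<i> * of_real (int_inner \<nu> \<omega> * t)) * ?d \<nu>) has_sum a) UNIV"
      by (rule has_sum_finite_neutralI[of "{0}"]) auto
    moreover have "(\<lambda>\<nu>. exp (\<i> * of_real (int_inner \<nu> \<omega> * t)) * c \<nu>) summable_on UNIV"
      by (rule abs_summable_summable) (use c in \<open>simp add: norm_mult\<close>)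
    ultimately show ?thesis
      unfolding distrib_left x by (intro has_sum_add has_sum_infsum)
  qed
  ultimately show ?thesis
    unfolding quasi_periodic_def by (intro exI[of _ "\<lambda>\<nu>. ?d \<nu> + c \<nu>"]) simp
qed

lemma damped_response_exists:
  fixes f :: "real ^ 'd \<Rightarrow> real"
  assumes an: "real_analytic f" and fc: "has_fourier_coeffs f fc"
    and \<kappa>: "0 < \<kappa>" and C: "C\<^sub>0 > 0" and dio: "diophantine C\<^sub>0 \<tau> \<omega>"
  shows "\<exists>R. damped_response (\<lambda>\<nu>. int_inner \<nu> \<omega>) (\<lambda>\<nu>. if \<nu> = 0 then 0 else fc \<nu>) \<kappa> R"
proof -
  let ?s = "\<lambda>\<nu>. int_inner \<nu> \<omega>" and ?c = "\<lambda>\<nu>. if \<nu> = 0 then 0 else fc \<nu>"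
  have sum: "(\<lambda>\<nu>. (1 + 1 / (?s \<nu>)\<^sup>2) * norm (?c \<nu>)) summable_on UNIV"
    by (rule summable_on_comparison_test[OF small_divisor_weight_summable[OF an fc dio C]])
      (auto intro!: mult_nonneg_nonneg add_nonneg_nonneg)
  define W where "W = 16 * (16 + 256 * \<kappa>) * (\<Sum>\<^sub>\<infinity>\<nu>. (1 + 1 / (?s \<nu>)\<^sup>2) * norm (?c \<nu>))"
  have W: "0 \<le> W"
    unfolding W_def using \<kappa> by (intro mult_nonneg_nonneg infsum_nonneg) (auto intro!: add_nonneg_nonneg)
  \<comment> \<open>The first bound yields R \<le> 1 and R^2 \<kappa> \<le> 1, the second the
    smallness condition; the added 1 keeps the denominator positive when \<open>W\<close> is
    0.\<close>
  define R where "R = min (1 / (\<kappa> + 1)) (\<kappa> / (W + 1))"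
  have R: "0 < R" "R \<le> 1 / (\<kappa> + 1)" "R \<le> \<kappa> / (W + 1)"
    using \<kappa> W by (auto simp: R_def)
  have R\<kappa>: "R * (\<kappa> + 1) \<le> 1" and RW: "R * (W + 1) \<le> \<kappa>"
    using R \<kappa> W by (simp_all add: pos_le_divide_eq)
  have R1: "R \<le> 1"
  proof -
    have "R * 1 \<le> R * (\<kappa> + 1)"
      using R \<kappa> by (intro mult_left_mono) auto
    then show ?thesis
      using R\<kappa> by simp
  qed
  have "R * (R * \<kappa>) \<le> 1 * 1"
    using R R1 R\<kappa> \<kappa> by (intro mult_mono) (auto simp: distrib_left)
  then have R2: "R\<^sup>2 * \<kappa> \<le> 1"
    by (simp add: power2_eq_square mult.assoc)
  have "damped_response ?s ?c \<kappa> R"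
  proof
    show "?s \<nu> \<noteq> 0" if "\<nu> \<noteq> 0" for \<nu> :: "int ^ 'd"
    proof -
      obtain j where "\<nu> $ j \<noteq> 0"
        using \<open>\<nu> \<noteq> 0\<close> by (auto simp: vec_eq_iff)
      then have "0 < \<bar>\<nu> $ j\<bar>"
        by simp
      also have "\<dots> \<le> int_l1_norm \<nu>"
        unfolding int_l1_norm_def by (rule member_le_sum) auto
      finally have "0 < C\<^sub>0 * real_of_int (int_l1_norm \<nu>) powr (- \<tau>)"
        using C by simp
      then show ?thesis
        using dio \<open>\<nu> \<noteq> 0\<close> unfolding diophantine_def by fastforce
    qed
    show "16 * R * (16 + 256 * \<kappa>) * (\<Sum>\<^sub>\<infinity>\<nu>. (1 + 1 / (?s \<nu>)\<^sup>2) * norm (?c \<nu>)) \<le> \<kappa>"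
    proof -
      have "16 * R * (16 + 256 * \<kappa>) * (\<Sum>\<^sub>\<infinity>\<nu>. (1 + 1 / (?s \<nu>)\<^sup>2) * norm (?c \<nu>)) = R * W"
        by (simp add: W_def)
      also have "\<dots> \<le> R * (W + 1)"
        using R by simp
      finally show ?thesis
        using RW by linarith
    qed
  qed (use sum R R1 R2 \<kappa> fourier_coeffs_cnj[OF fc] in \<open>auto simp: int_inner_add_left\<close>)
  then show ?thesis
    by blast
qed

theorem theorem3:
  fixes f :: "real ^ 'd \<Rightarrow> real"
    and fc :: "int ^ 'd \<Rightarrow> complex"
    and \<omega> :: "real ^ 'd"
    and \<alpha> C\<^sub>0 \<tau> :: real
  assumes "real_analytic f"
    and "multi_periodic f"
    and "has_fourier_coeffs f fc"
    and "fc 0 = complex_of_real \<alpha>"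
    and "\<alpha> > 0"
    and "C\<^sub>0 > 0"
    and "\<tau> > 0"
    and "diophantine C\<^sub>0 \<tau> \<omega>"
  shows "\<exists>\<epsilon>\<^sub>0>0. \<exists>x :: real \<Rightarrow> real \<Rightarrow> real.
           (\<forall>\<epsilon>. \<bar>\<epsilon>\<bar> < \<epsilon>\<^sub>0 \<longrightarrow>
              quasi_periodic \<omega> (\<lambda>t. complex_of_real (x \<epsilon> t)) \<and> is_solution f \<omega> \<epsilon> (x \<epsilon>)) \<and>
           (\<exists>X :: complex \<Rightarrow> real \<Rightarrow> complex.
              (\<forall>t. (\<lambda>\<epsilon>. X \<epsilon> t) analytic_on (D_dom \<epsilon>\<^sub>0 - {0})) \<and>
              (\<forall>\<epsilon> t. \<bar>\<epsilon>\<bar> < \<epsilon>\<^sub>0 \<and> \<epsilon> \<noteq> 0 \<longrightarrow>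
                 X (complex_of_real \<epsilon>) t = complex_of_real (x \<epsilon> t)))"
proof -
  define \<kappa> where "\<kappa> = 2 * sqrt \<alpha>"
  define c where "c = (\<lambda>\<nu>. if \<nu> = 0 then 0 else fc \<nu>)"
  have \<kappa>: "0 < \<kappa>"
    using \<open>\<alpha> > 0\<close> by (simp add: \<kappa>_def)
  obtain R where "damped_response (\<lambda>\<nu>. int_inner \<nu> \<omega>) c \<kappa> R"
    using damped_response_exists[OF assms(1,3) \<kappa> assms(6,8)] unfolding c_def by blast
  then interpret D: damped_response "\<lambda>\<nu>. int_inner \<nu> \<omega>" c \<kappa> R .
  define X where "X \<epsilon> t = of_real (sqrt \<alpha>) + (\<Sum>\<^sub>\<infinity>\<nu>. exp (\<i> * of_real (int_inner \<nu> \<omega> * t)) * D.response \<epsilon> \<nu>)" for \<epsilon> t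
  \<comment> \<open>At e = 0 the equation reduces to x' = 0; among its constant solutions the
    zeroth-order term sqrt \<alpha> is taken.\<close>
  define x where "x e t = (if e = 0 then sqrt \<alpha> else Re (X (of_real e) t))" for e t
  have XS: "X (of_real e) t = of_real (sqrt \<alpha>) + D.S0 e t" if "e \<noteq> 0" "\<bar>e\<bar> < R" for e t
    by (simp add: X_def D.S0_def[OF that])
  have Xx: "X (of_real e) t = of_real (x e t)" if "e \<noteq> 0" "\<bar>e\<bar> < R" for e t
    using D.S0_real[OF that, of t] that by (simp add: x_def XS complex_eq_iff)
  have "(\<lambda>\<epsilon>. X \<epsilon> t) analytic_on (D_dom R - {0})" for t
  proof -
    \<comment> \<open>Analyticity is local, so each point may use its own sector; \<open>X\<close>
      does not depend on that choice.\<close>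
    have "(\<lambda>\<epsilon>. X \<epsilon> t) analytic_on {\<epsilon>}" if \<epsilon>: "\<epsilon> \<in> D_dom R - {0}" for \<epsilon>
    proof -
      obtain l where l: "0 < l" "l \<le> 1" "\<epsilon> \<in> sector R l"
        using punctured_D_dom_covered[OF \<epsilon>] .
      have "(\<lambda>\<epsilon>. X \<epsilon> t) holomorphic_on sector R l"
        unfolding X_def by (intro holomorphic_on_add holomorphic_on_const D.response_sum_holomorphic l)
      then show ?thesis
        using l(3) open_sector[of R l] analytic_at by blast
    qed
    then show ?thesis
      using analytic_on_analytic_at by blast
  qed
  moreover have "quasi_periodic \<omega> (\<lambda>t. of_real (x e t))" if "\<bar>e\<bar> < R" for e
  proof (cases "e = 0")
    case True
    show ?thesis
      by (rule quasi_periodic_offset_sum[where c = "\<lambda>_. 0" and a = "of_real (sqrt \<alpha>)"]) (simp_all add: True x_def)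
  next
    case False
    show ?thesis
      by (rule quasi_periodic_offset_sum[OF D.u_abs_summable[OF False that], of _ "of_real (sqrt \<alpha>)"])
        (simp add: Xx[OF False that, symmetric] X_def)
  qed
  moreover have "is_solution f \<omega> e (x e)" if R: "\<bar>e\<bar> < R" for e
  proof (cases "e = 0")
    case True
    then show ?thesis
      unfolding is_solution_def by (intro exI[of _ "\<lambda>_. 0"]) (auto simp: x_def[abs_def])
  next
    case False
    note eR = False R
    have "(x e has_real_derivative Re (D.S1 e t)) (at t)" for t
    proof -
      have "(\<lambda>t. sqrt \<alpha> + Re (D.S0 e t)) = x e"
        using False by (auto simp: x_def XS[OF eR])
      moreover have "((\<lambda>t. sqrt \<alpha> + Re (D.S0 e t)) has_vector_derivative 0 + Re (D.S1 e t)) (at t)"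
        by (intro has_vector_derivative_add has_vector_derivative_const
            bounded_linear.has_vector_derivative[OF bounded_linear_Re] D.S0_deriv eR)
      ultimately show ?thesis
        by (simp add: has_real_derivative_iff_has_vector_derivative)
    qed
    moreover have "((\<lambda>t. Re (D.S1 e t)) has_real_derivative Re (D.S2 e t)) (at t)" for t
      unfolding has_real_derivative_iff_has_vector_derivative
      by (intro bounded_linear.has_vector_derivative[OF bounded_linear_Re] D.S1_deriv eR)
    moreover have "e * Re (D.S2 e t) + Re (D.S1 e t) + e * (x e t)\<^sup>2 = e * f (t *\<^sub>R \<omega>)" for t
    proof -
      let ?E = "\<lambda>\<nu>. exp (\<i> * of_real (int_inner \<nu> \<omega> * t)) :: complex"
      have "((\<lambda>\<nu>. ?E \<nu> * fc \<nu>) has_sum of_real (f (t *\<^sub>R \<omega>))) UNIV"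
        using \<open>has_fourier_coeffs f fc\<close>[unfolded has_fourier_coeffs_def, rule_format, of "t *\<^sub>R \<omega>"]
        by (simp only: int_inner_scaleR)
      moreover have "((\<lambda>\<nu>. if \<nu> = 0 then - fc 0 else 0) has_sum - fc 0) UNIV"
        by (rule has_sum_finite_neutralI[of "{0}"]) auto
      ultimately have "((\<lambda>\<nu>. ?E \<nu> * fc \<nu> + (if \<nu> = 0 then - fc 0 else 0)) has_sum (of_real (f (t *\<^sub>R \<omega>)) + - fc 0)) UNIV"
        by (rule has_sum_add)
      moreover have "?E \<nu> * fc \<nu> + (if \<nu> = 0 then - fc 0 else 0) = ?E \<nu> * c \<nu>" for \<nu>
        by (simp add: c_def)
      ultimately have "(\<Sum>\<^sub>\<infinity>\<nu>. ?E \<nu> * c \<nu>) = of_real (f (t *\<^sub>R \<omega>)) - of_real \<alpha>"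
        using \<open>fc 0 = complex_of_real \<alpha>\<close> by (simp add: infsumI)
      with D.S_equation[OF eR, of t]
      have eq: "of_real e * D.S2 e t + D.S1 e t + of_real e * (of_real \<kappa> * D.S0 e t + (D.S0 e t)\<^sup>2)
          = of_real e * (of_real (f (t *\<^sub>R \<omega>)) - of_real \<alpha>)"
        by simp
      have S0: "D.S0 e t = of_real (x e t - sqrt \<alpha>)"
        using XS[OF eR, of t] Xx[OF eR, of t] by (simp add: algebra_simps)
      have "e * Re (D.S2 e t) + Re (D.S1 e t) + e * (\<kappa> * (x e t - sqrt \<alpha>) + (x e t - sqrt \<alpha>)\<^sup>2)
          = e * (f (t *\<^sub>R \<omega>) - \<alpha>)"
        using arg_cong[OF eq, of Re] unfolding S0 by (simp flip: of_real_mult of_real_power of_real_add of_real_diff)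
      moreover have "\<kappa> * (x e t - sqrt \<alpha>) + (x e t - sqrt \<alpha>)\<^sup>2 = (x e t)\<^sup>2 - (sqrt \<alpha>)\<^sup>2"
        by (simp add: \<kappa>_def power2_eq_square algebra_simps)
      ultimately show ?thesis
        using \<open>\<alpha> > 0\<close> by (simp add: right_diff_distrib)
    qed
    ultimately show ?thesis
      unfolding is_solution_def
      by (intro exI[of _ "\<lambda>t. Re (D.S1 e t)"] exI[of _ "\<lambda>t. Re (D.S2 e t)"]) simp
  qed
  ultimately show ?thesis
    using D.R(1) Xx by (intro exI[of _ R] conjI exI[of _ x] exI[of _ X]) auto
qed

end
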